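(* Let $k\ge 2$ be even. Then \[ Z_k(0)=\frac{1}{(k-1)!}\sum_{h=0}^{\frac{k-2}{2}}B_{k,k-2h-1}\left(\left[2^{2h+1-k}-1\right]\zeta\left(2h+1-k\right)+\frac{1}{k-2h}\left(\frac{k-1}{2}\right)^{k-2h}\right)-1. \] Moreover, if $n$ is a positive integer, \[ \begin{split} Z_k(-n)=\frac{1}{(k-1)!}\sum_{h=0}^{\frac{k-2}{2}}B_{k,k-2h-1}\Bigg(&\sum_{l=0}^n (-1)^l\binom{n}{l}\left(\frac{k-1}{2}\right)^{2l}\left[2^{2h+1+2l-2n-k}-1\right]\zeta\left(2h+1+2l-2n-k\right)\\ &+\frac{(-1)^n n!}{2}\,\frac{\Gamma\left( \frac{k-2h}{2} \right)}{\Gamma\left( \frac{k-2h}{2}+n+1\right)}\left(\frac{k-1}{2}\right)^{k-2h+2n}\Bigg). \end{split} \]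
   Context: $\zeta$ denotes the Riemann zeta function. For an integer $k\ge 2$ and integer $n\ge 0$, $P_k(n)=\frac{(2n+k-1)(n+1)(n+2)\cdots(n+k-2)}{(k-1)!}$ (for $k=2$ the product $(n+1)\cdots(n+k-2)$ is empty and equals $1$). The Minakshisundaram–Pleijel zeta function of the unit sphere $S^k$ is $Z_k(s)=\sum_{n=1}^{\infty}\frac{P_k(n)}{[n(n+k-1)]^s}$, absolutely convergent for $\mathrm{Re}\,s>k/2$; $Z_k$ also denotes its meromorphic continuation to $\mathbb{C}$, which is holomorphic at nonpositive integers when $k$ is even. The Stirling numbers of the first kind $s_{n,m}$ are defined by $x(x+1)\cdots(x+n-1)=\sum_{m=0}^{n}(-1)^{n+m}s_{n,m}x^m$, and for $0\le j\le k-1$, \[ B_{k,j}=\sum_{p=0}^{k-j-1}(-1)^{k+j+1}\binom{j+p}{j}\left(\frac{k-1}{2}\right)^p\left(s_{k,j+p+1}+s_{k-1,j+p}\right). \] (Equivalently, $\sum_{j=0}^{k-1}B_{k,j}x^j=(k-1)!\,P_k\!\left(x-\frac{k-1}{2}\right)$.) *)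

theory Defs
  imports "HOL-Complex_Analysis.Complex_Analysis" "HOL-Combinatorics.Stirling"
begin

text \<open>
  The meromorphic continuation to \<open>\<complex>\<close> of a function given on the half-plane \<open>Re s > \<sigma>\<close>.
  Requiring \<open>nicely_meromorphic_on\<close> fixes the value at every removable singularity by continuity
  and at every pole to be 0, so there is at most one such function (see the lemma
  \<open>meromorphic_continuation_eqI\<close> below).
\<close>

definition meromorphic_continuation :: "real \<Rightarrow> (complex \<Rightarrow> complex) \<Rightarrow> complex \<Rightarrow> complex" where
  "meromorphic_continuation \<sigma> f =
     (THE F. F nicely_meromorphic_on UNIV \<and> (\<forall>s. Re s > \<sigma> \<longrightarrow> F s = f s))"

lemma nicely_meromorphic_eqI:
  assumes F: "F nicely_meromorphic_on UNIV" and G: "G nicely_meromorphic_on UNIV"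
    and eq: "\<And>s. Re s > \<sigma> \<Longrightarrow> F s = G s"
  shows "F = G"
proof -
  have mer: "(\<lambda>s. F s - G s) meromorphic_on UNIV"
    using F G unfolding nicely_meromorphic_on_def by (intro meromorphic_intros) auto
  have "(\<forall>\<^sub>\<approx>s\<in>UNIV. F s - G s = 0) \<or> (\<forall>\<^sub>\<approx>s\<in>UNIV. F s - G s \<noteq> 0)"
    using meromorphic_imp_constant_or_avoid[OF mer, of 0] by (simp add: connected_UNIV)
  moreover have "\<not> (\<forall>\<^sub>\<approx>s\<in>UNIV. F s - G s \<noteq> 0)"
  proof
    define p where "p = complex_of_real (\<sigma> + 1)"
    assume "\<forall>\<^sub>\<approx>s\<in>UNIV. F s - G s \<noteq> 0"
    hence "eventually (\<lambda>s. F s - G s \<noteq> 0) (at p)"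
      by (simp add: eventually_cosparse_open_eq)
    moreover have "eventually (\<lambda>s. s \<in> {s. Re s > \<sigma>}) (at p)"
      by (rule eventually_at_in_open') (auto simp: p_def open_halfspace_Re_gt)
    ultimately have "eventually (\<lambda>s. False) (at p)"
      by eventually_elim (use eq in auto)
    thus False by simp
  qed
  ultimately have ev: "eventually (\<lambda>s. F s = G s) (at z)" for z
    by (auto simp: eventually_cosparse_open_eq)
  show "F = G"
  proof
    fix z
    have pole: "is_pole F z \<longleftrightarrow> is_pole G z"
      by (rule is_pole_cong) (use ev in auto)
    have lim: "F \<midarrow>z\<rightarrow> l \<longleftrightarrow> G \<midarrow>z\<rightarrow> l" for l
      by (rule filterlim_cong) (use ev in auto)
    have Fz: "is_pole F z \<and> F z = 0 \<or> F \<midarrow>z\<rightarrow> F z" and Gz: "is_pole G z \<and> G z = 0 \<or> G \<midarrow>z\<rightarrow> G z"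
      using F G unfolding nicely_meromorphic_on_def by auto
    have no: "\<not> is_pole G z" if "G \<midarrow>z\<rightarrow> l" for l
      using that not_tendsto_and_filterlim_at_infinity[of "at z" G l] unfolding is_pole_def by auto
    show "F z = G z"
      using Fz Gz no pole lim LIM_unique by metis
  qed
qed

lemma meromorphic_continuation_eqI:
  assumes "F nicely_meromorphic_on UNIV" and "\<And>s. Re s > \<sigma> \<Longrightarrow> F s = f s"
  shows "meromorphic_continuation \<sigma> f = F"
  unfolding meromorphic_continuation_def
proof (rule the_equality)
  fix G assume "G nicely_meromorphic_on UNIV \<and> (\<forall>s. Re s > \<sigma> \<longrightarrow> G s = f s)"
  thus "G = F" using assms by (intro nicely_meromorphic_eqI[of G F \<sigma>]) auto
qed (use assms in auto)

definition zeta :: "complex \<Rightarrow> complex" where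
  "zeta = meromorphic_continuation 1 (\<lambda>s. \<Sum>n. 1 / of_nat (Suc n) powr s)"

definition P :: "nat \<Rightarrow> nat \<Rightarrow> complex" where
  "P k n = of_nat (2 * n + k - 1) * (\<Prod>i = 1..k - 2. of_nat (n + i)) / fact (k - 1)"

definition Z :: "nat \<Rightarrow> complex \<Rightarrow> complex" where
  "Z k = meromorphic_continuation (real k / 2)
           (\<lambda>s. \<Sum>n. P k (Suc n) / of_nat (Suc n * (Suc n + k - 1)) powr s)"

text \<open>Signed Stirling numbers of the first kind; the library's \<open>stirling\<close> is unsigned.\<close>

definition stirling1 :: "nat \<Rightarrow> nat \<Rightarrow> int" where
  "stirling1 n m = (-1) ^ (n + m) * int (stirling n m)"

lemma pochhammer_stirling1:
  fixes x :: "'a :: comm_ring_1"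
  shows "(\<Prod>i<n. x + of_nat i) = (\<Sum>m\<le>n. (-1) ^ (n + m) * of_int (stirling1 n m) * x ^ m)"
proof -
  have "(-1) ^ (n + m) * of_int (stirling1 n m) = (of_nat (stirling n m) :: 'a)" for m
    by (simp add: stirling1_def flip: mult.assoc power_mult_distrib)
  thus ?thesis
    using stirling_pochhammer[of n x] by (simp add: pochhammer_prod atLeast0LessThan)
qed

definition B :: "nat \<Rightarrow> nat \<Rightarrow> complex" where
  "B k j = (\<Sum>p = 0..k - j - 1. (-1) ^ (k + j + 1) * of_nat ((j + p) choose j)
              * (of_nat (k - 1) / 2) ^ p
              * of_int (stirling1 k (j + p + 1) + stirling1 (k - 1) (j + p)))"

end

theory Submission
  imports Defs
begin

text \<open>
  Let \<open>k = 2 * K\<close>, \<open>a = K - 1/2\<close> and \<open>x = n + a\<close>. Then \<open>n (n + k - 1) = x\<^sup>2 - a\<^sup>2\<close>, while \<open>P k n\<close> is an odd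
  polynomial in \<open>x\<close>. Expanding \<open>(x\<^sup>2 - a\<^sup>2) powr (-s)\<close> in powers of \<open>x\<close> by the binomial series, cut off after \<open>L\<close>
  terms, writes \<open>Z k s\<close> as a finite combination of the functions \<open>\<Sum>x. x powr (-w)\<close> with
  \<open>w = 2 * (s + l - m) + 1\<close> plus a remainder that is holomorphic for \<open>Re s > K - L\<close> and vanishes at
  nonpositive integers \<open>s > - L\<close>. Summing over half-integers gives \<open>(2 powr w - 1) * zeta w\<close> minus the terms
  with \<open>x \<le> a\<close>. In the end the latter only contribute the summand \<open>-1\<close> of \<open>Z k 0\<close>, because \<open>P k\<close>
  vanishes at \<open>x = 1/2, \<dots>, a - 1\<close>. The same expansion of \<open>(x + 1) powr (1 - s)\<close> continues the Riemann
  zeta function itself.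
\<close>

section \<open>Locally uniform sums and continuation from half-planes\<close>

text \<open>Weierstrass' test. The exponent \<open>v\<close> may vary with \<open>s\<close>: by
  continuity it stays below some constant \<open>p < -1\<close> near each point, which yields a
  majorant independent of \<open>s\<close> there.\<close>

lemma holomorphic_suminf:
  fixes f :: "nat \<Rightarrow> complex \<Rightarrow> complex" and v :: "complex \<Rightarrow> real"
  assumes U: "open U" and hol: "\<And>n. f n holomorphic_on U"
    and v: "continuous_on U v" and v_less: "\<And>s. s \<in> U \<Longrightarrow> v s < -1"
    and bound: "\<And>z. z \<in> U \<Longrightarrow> \<exists>r>0. \<exists>C. \<forall>s\<in>ball z r \<inter> U. \<forall>n. norm (f n s) \<le> C * real (Suc n) powr v s"
  shows "(\<lambda>s. \<Sum>n. f n s) holomorphic_on U" and "\<And>s. s \<in> U \<Longrightarrow> summable (\<lambda>n. f n s)"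
proof -
  have ex: "\<exists>d h. 0 < d \<and> summable h \<and> range h \<subseteq> \<real>\<^sub>\<ge>\<^sub>0 \<and>
      (\<forall>\<^sub>F n in sequentially. \<forall>y\<in>ball z d \<inter> U. cmod (f n y) \<le> cmod (h n))" if z: "z \<in> U" for z
  proof -
    obtain r C where r: "r > 0" "\<And>s n. s \<in> ball z r \<inter> U \<Longrightarrow> norm (f n s) \<le> C * real (Suc n) powr v s"
      using bound[OF z] by blast
    \<comment> \<open>The midpoint of \<open>v z\<close> and \<open>-1\<close>.\<close>
    define p where "p = (v z - 1) / 2"
    have p: "v z < p" "p < -1" using v_less[OF z] by (auto simp: p_def field_simps)
    have "open ({..<p} :: real set)" by simp
    hence "open (v -` {..<p} \<inter> U)" using v U continuous_on_open_vimage by blast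
    moreover have "z \<in> v -` {..<p} \<inter> U" using z p by auto
    ultimately obtain e where e: "e > 0" "ball z e \<subseteq> v -` {..<p} \<inter> U"
      using open_contains_ball by meson
    define h where "h = (\<lambda>n. complex_of_real (\<bar>C\<bar> * real (Suc n) powr p))"
    have "summable (\<lambda>n. real (Suc n) powr p)"
      using summable_real_powr_iff[of p] p by (subst summable_Suc_iff) auto
    hence "summable h" unfolding h_def by (intro summable_of_real summable_mult)
    moreover have "range h \<subseteq> \<real>\<^sub>\<ge>\<^sub>0" by (auto simp: h_def simp flip: of_real_mult)
    moreover have "cmod (f n y) \<le> cmod (h n)" if y: "y \<in> ball z (min r e) \<inter> U" for n y
    proof -
      have "v y \<le> p" using e y by force
      hence "real (Suc n) powr v y \<le> real (Suc n) powr p" by (intro powr_mono) auto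
      hence "C * real (Suc n) powr v y \<le> \<bar>C\<bar> * real (Suc n) powr p"
        by (intro mult_mono) auto
      also have "\<dots> = cmod (h n)" unfolding h_def norm_of_real by simp
      finally show ?thesis using r(2)[of y n] y by auto
    qed
    moreover have "min r e > 0" using r e by auto
    ultimately show ?thesis by (intro exI[of _ "min r e"] exI[of _ h]) auto
  qed
  have fd: "f n field_differentiable at x" if "x \<in> U" for n x
    using hol[of n] U that holomorphic_on_imp_differentiable_at by blast
  obtain g where g: "\<forall>x\<in>U. (\<lambda>n. f n x) sums g x \<and> g field_differentiable at x"
    using series_differentiable_comparison_complex[OF U fd ex] by blast
  have "g holomorphic_on U" using g
    by (auto simp: holomorphic_on_def intro: field_differentiable_at_within)
  moreover have "(\<Sum>n. f n s) = g s" if "s \<in> U" for s using g that by (auto simp: sums_iff)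
  ultimately show "(\<lambda>s. \<Sum>n. f n s) holomorphic_on U" by (simp cong: holomorphic_cong)
  show "summable (\<lambda>n. f n s)" if "s \<in> U" for s using g that by (auto simp: sums_iff)
qed

section \<open>Remainders of the binomial series\<close>

text \<open>Taken as a difference and not as the tail of a series, so that expansions are identities
  without any question of convergence and holomorphy in the exponent is evident.\<close>

definition binrem :: "nat \<Rightarrow> complex \<Rightarrow> complex \<Rightarrow> complex" where
  "binrem L \<alpha> u = (1 + u) powr \<alpha> - (\<Sum>l<L. (\<alpha> gchoose l) * u ^ l)"

text \<open>Each factor satisfies \<open>norm (\<alpha> - of_nat i) \<le> M + i\<close>. The
  resulting bounds are the coefficients of \<open>(1 - q) powr (-M)\<close> as a series in
  \<open>q\<close>, a majorant for all such \<open>\<alpha>\<close> at once.\<close>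

lemma norm_gbinomial_le:
  fixes \<alpha> :: complex
  assumes "norm \<alpha> \<le> M"
  shows "norm (\<alpha> gchoose n) \<le> (-1) ^ n * ((-M) gchoose n)"
proof -
  have M: "0 \<le> M" using assms norm_ge_zero order_trans by blast
  have "norm (\<alpha> gchoose n) = (\<Prod>i=0..<n. norm (\<alpha> - of_nat i)) / fact n"
    by (simp add: gbinomial_prod_rev norm_divide prod_norm)
  also have "\<dots> \<le> (\<Prod>i=0..<n. M + real i) / fact n"
    using norm_triangle_ineq4 assms M
    by (intro divide_right_mono prod_mono) (auto intro: order_trans[OF norm_triangle_ineq4])
  also have "(\<Prod>i=0..<n. M + real i) = (\<Prod>i=0..<n. (-1) * (-M - real i))"
    by (simp add: add.commute)
  also have "\<dots> = (-1) ^ n * (\<Prod>i=0..<n. -M - real i)"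
    by (subst prod.distrib) simp
  finally show ?thesis by (simp add: gbinomial_prod_rev)
qed

text \<open>Inside the disc the remainder is the tail of the binomial series. Taking out
  \<open>u ^ L\<close> leaves a series dominated by the tail of \<open>(1 - q) powr (-M)\<close>
  divided by \<open>q ^ L\<close>, so one constant serves all \<open>\<alpha>\<close> and
  \<open>u\<close>.\<close>

lemma binrem_bound:
  assumes q: "0 < q" "q < 1"
  shows "\<exists>C. \<forall>\<alpha> u. norm \<alpha> \<le> M \<longrightarrow> norm u \<le> q \<longrightarrow> norm (binrem L \<alpha> u) \<le> C * norm u ^ L"
proof -
  define c where "c = (\<lambda>n. (-1) ^ n * ((-M) gchoose n))"
  have "summable (\<lambda>n. ((-M) gchoose n) * (-q) ^ n)"
    using gen_binomial_real[of "-q" "-M"] q by (auto simp: sums_iff)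
  also have "(\<lambda>n. ((-M) gchoose n) * (-q) ^ n) = (\<lambda>n. c n * q ^ n)"
    by (auto simp: c_def power_minus[of q] mult_ac)
  finally have "summable (\<lambda>n. c (n + L) * q ^ (n + L))" by (rule summable_ignore_initial_segment)
  hence "summable (\<lambda>n. c (n + L) * q ^ (n + L) / q ^ L)" by (rule summable_divide)
  hence sm: "summable (\<lambda>n. c (n + L) * q ^ n)" using q by (simp add: power_add)
  show ?thesis
  proof (intro exI allI impI)
    fix \<alpha> u :: complex assume \<alpha>: "norm \<alpha> \<le> M" and u: "norm u \<le> q"
    have "(\<lambda>n. (\<alpha> gchoose n) * u ^ n) sums ((1 + u) powr \<alpha>)"
      using u q by (intro gen_binomial_complex) auto
    hence s: "(\<lambda>n. (\<alpha> gchoose (n + L)) * u ^ (n + L)) sums binrem L \<alpha> u"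
      unfolding binrem_def by (rule sums_split_initial_segment)
    have le: "norm ((\<alpha> gchoose (n + L)) * u ^ (n + L)) \<le> c (n + L) * q ^ n * norm u ^ L" for n
    proof -
      have cn: "norm (\<alpha> gchoose (n + L)) \<le> c (n + L)"
        unfolding c_def by (rule norm_gbinomial_le[OF \<alpha>])
      have "norm ((\<alpha> gchoose (n + L)) * u ^ (n + L)) = norm (\<alpha> gchoose (n + L)) * norm u ^ n * norm u ^ L"
        by (simp add: norm_mult norm_power power_add)
      also have "\<dots> \<le> c (n + L) * q ^ n * norm u ^ L"
        using cn u q by (intro mult_mono power_mono mult_nonneg_nonneg order_trans[OF norm_ge_zero cn]) auto
      finally show ?thesis .
    qed
    show "norm (binrem L \<alpha> u) \<le> (\<Sum>n. c (n + L) * q ^ n) * norm u ^ L"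
      using norm_suminf_le[OF le summable_mult2[OF sm]] s by (simp add: sums_iff suminf_mult2[OF sm])
  qed
qed

text \<open>The binomial series of a natural exponent terminates. This kills the remainders where
  values are wanted: exponent \<open>1 - s\<close> at \<open>s = 1\<close> for zeta, exponent
  \<open>- s\<close> at \<open>s = -n\<close> for the sphere.\<close>

lemma binrem_of_nat: "n < L \<Longrightarrow> norm u < 1 \<Longrightarrow> binrem L (of_nat n) u = 0"
proof -
  assume n: "n < L" and u: "norm u < 1"
  have "(\<lambda>l. (of_nat n gchoose l) * u ^ l) sums (\<Sum>l<L. (of_nat n gchoose l) * u ^ l)"
    using n by (intro sums_finite) (auto simp flip: binomial_gbinomial)
  from sums_unique2[OF this gen_binomial_complex[OF u, of "of_nat n"]]
  show ?thesis by (simp add: binrem_def)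
qed

lemma holomorphic_on_powr_real [holomorphic_intros]:
  "w holomorphic_on U \<Longrightarrow> x > 0 \<Longrightarrow> (\<lambda>s. complex_of_real x powr w s) holomorphic_on U"
  by (auto simp: powr_def intro!: holomorphic_intros)

lemma binrem_holomorphic [holomorphic_intros]:
  assumes "\<alpha> holomorphic_on U" "u \<noteq> -1"
  shows "(\<lambda>s. binrem L (\<alpha> s) u) holomorphic_on U"
proof -
  have "1 + u \<noteq> 0" using assms by (metis add.inverse_inverse add_eq_0_iff)
  thus ?thesis using assms unfolding binrem_def gbinomial_prod_rev
    by (auto simp: powr_def intro!: holomorphic_intros)
qed

text \<open>As \<open>u\<close> is of order \<open>x powr (-d)\<close>, the terms are of order
  \<open>x powr (Re w - d * L)\<close>. Raising \<open>L\<close> therefore enlarges the region of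
  convergence. Zeta uses \<open>d = 1\<close>, the sphere \<open>d = 2\<close>.\<close>

lemma binrem_sum_holomorphic:
  fixes x u :: "nat \<Rightarrow> real"
  assumes U: "open U" and w: "w holomorphic_on U" and \<alpha>: "\<alpha> holomorphic_on U"
    and x: "\<And>n. x n \<ge> real (Suc n)" and q: "0 < q" "q < 1"
    and u: "\<And>n. \<bar>u n\<bar> \<le> q" "\<And>n. \<bar>u n\<bar> \<le> D / x n ^ d"
    and less: "\<And>s. s \<in> U \<Longrightarrow> Re (w s) < real d * real L - 1"
  defines "f \<equiv> (\<lambda>n s. of_real (x n) powr w s * binrem L (\<alpha> s) (of_real (u n)))"
  shows "(\<lambda>s. \<Sum>n. f n s) holomorphic_on U" and "\<And>s. s \<in> U \<Longrightarrow> summable (\<lambda>n. f n s)"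
proof -
  define v where "v = (\<lambda>s. Re (w s) - real (d * L))"
  have x0: "x n > 0" for n using x[of n] by simp
  have une: "of_real (u n) \<noteq> (-1 :: complex)" for n
  proof
    assume "of_real (u n) = (-1 :: complex)"
    hence "u n = -1" by (metis of_real_eq_iff of_real_minus of_real_1)
    with u(1)[of n] q show False by auto
  qed
  have hol: "f n holomorphic_on U" for n
    unfolding f_def using x0 une by (intro holomorphic_intros w \<alpha>) auto
  have cv: "continuous_on U v" unfolding v_def
    using w by (intro continuous_intros holomorphic_on_imp_continuous_on)
  have vl: "v s < -1" if "s \<in> U" for s using less[OF that] by (simp add: v_def)
  have bd: "\<exists>r>0. \<exists>C. \<forall>s\<in>ball z r \<inter> U. \<forall>n. norm (f n s) \<le> C * real (Suc n) powr v s" if z: "z \<in> U" for z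
  proof -
    \<comment> \<open>Near \<open>z\<close> the exponent moves by less than 1, so \<open>M\<close>
      bounds it there and \<open>binrem_bound\<close> supplies a single constant.\<close>
    define M where "M = norm (\<alpha> z) + 1"
    have "continuous_on U \<alpha>" using \<alpha> holomorphic_on_imp_continuous_on by blast
    hence "open (\<alpha> -` ball (\<alpha> z) 1 \<inter> U)" using U continuous_on_open_vimage by blast
    moreover have "z \<in> \<alpha> -` ball (\<alpha> z) 1 \<inter> U" using z by auto
    ultimately obtain r where r: "r > 0" "ball z r \<subseteq> \<alpha> -` ball (\<alpha> z) 1 \<inter> U"
      using open_contains_ball by meson
    obtain C where C: "\<And>\<alpha> u. norm \<alpha> \<le> M \<Longrightarrow> norm u \<le> q \<Longrightarrow> norm (binrem L \<alpha> u) \<le> C * norm u ^ L"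
      using binrem_bound[OF q] by blast
    have "norm (f n s) \<le> (\<bar>C\<bar> * \<bar>D\<bar> ^ L) * real (Suc n) powr v s" if s: "s \<in> ball z r \<inter> U" for s n
    proof -
      have "dist (\<alpha> z) (\<alpha> s) < 1" using r s by auto
      hence "norm (\<alpha> s) \<le> M" unfolding M_def using norm_triangle_sub[of "\<alpha> s" "\<alpha> z"]
        by (simp add: dist_norm norm_minus_commute)
      hence "norm (binrem L (\<alpha> s) (of_real (u n))) \<le> C * \<bar>u n\<bar> ^ L"
        using C[of "\<alpha> s" "of_real (u n)"] u(1)[of n] by simp
      also have "\<dots> \<le> \<bar>C\<bar> * (\<bar>D\<bar> / x n ^ d) ^ L"
        using x0[of n]
        by (intro mult_mono power_mono order_trans[OF u(2)] divide_right_mono) auto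
      also have "\<dots> = \<bar>C\<bar> * \<bar>D\<bar> ^ L * x n powr (- real (d * L))"
        using x0[of n] by (subst powr_minus, subst powr_realpow) (simp_all add: power_mult_distrib power_inverse power_mult divide_inverse)
      finally have "norm (f n s) \<le> x n powr Re (w s) * (\<bar>C\<bar> * \<bar>D\<bar> ^ L * x n powr (- real (d * L)))"
        unfolding f_def using x0[of n] by (simp add: norm_mult norm_powr_real_powr mult_left_mono del: of_nat_mult)
      also have "\<dots> = \<bar>C\<bar> * \<bar>D\<bar> ^ L * x n powr v s"
        unfolding v_def by (simp add: powr_diff powr_minus divide_inverse del: of_nat_mult)
      \<comment> \<open>The exponent \<open>v s\<close> is negative, so lowering the base from
        \<open>x n\<close> to \<open>Suc n\<close> can only increase the power.\<close>
      also have "\<dots> \<le> \<bar>C\<bar> * \<bar>D\<bar> ^ L * real (Suc n) powr v s"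
        using x[of n] vl[of s] s by (intro mult_left_mono powr_mono2') auto
      finally show ?thesis .
    qed
    thus ?thesis using r by blast
  qed
  show "(\<lambda>s. \<Sum>n. f n s) holomorphic_on U" "\<And>s. s \<in> U \<Longrightarrow> summable (\<lambda>n. f n s)"
    using holomorphic_suminf[OF U hol cv vl bd] by auto
qed

section \<open>Gluing continuations along half-planes\<close>

lemma half_plane_eqI:
  assumes "f holomorphic_on {s. Re s > d}" "g holomorphic_on {s. Re s > d}"
    and "\<And>s. Re s > c \<Longrightarrow> f s = g s" and "Re z > d"
  shows "f z = g z"
proof (rule analytic_continuation_open[where f = f and g = g and s = "{s. Re s > max c d}" and s' = "{s. Re s > d}"])
  have "complex_of_real (max c d + 1) \<in> {s. Re s > max c d}" by auto
  thus "{s. Re s > max c d} \<noteq> {}" by blast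
  show "open {s. Re s > max c d}" by (rule open_halfspace_Re_gt)
  show "connected {s. Re s > d}" by (intro convex_connected convex_halfspace_Re_gt)
qed (use assms in \<open>auto simp: open_halfspace_Re_gt\<close>)

text \<open>By the identity theorem any two of the continuations agree on the smaller half-plane, so
  they glue together.\<close>

lemma entire_from_half_planes:
  fixes f :: "complex \<Rightarrow> complex"
  assumes "\<And>N::nat. \<exists>g. g holomorphic_on {s. Re s > - real N} \<and> (\<forall>s. Re s > c \<longrightarrow> g s = f s)"
  obtains g where "g holomorphic_on UNIV" "\<And>s. Re s > c \<Longrightarrow> g s = f s"
proof -
  obtain G where G: "\<And>N::nat. G N holomorphic_on {s. Re s > - real N}"
      "\<And>N s. Re s > c \<Longrightarrow> G N s = f s"
    using assms by metis
  have eq: "G N s = G M s" if NM: "N \<le> M" and s: "Re s > - real N" for N M s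
  proof (rule half_plane_eqI[of "G N" "- real N" "G M" c])
    show "G M holomorphic_on {s. Re s > - real N}"
      using NM by (intro holomorphic_on_subset[OF G(1)[of M]]) auto
  qed (use G s in auto)
  \<comment> \<open>Any index \<open>N\<close> with \<open>Re s > - N\<close> gives the same value;
    this is one such choice.\<close>
  define g where "g = (\<lambda>s. G (nat \<lceil>\<bar>Re s\<bar>\<rceil> + 1) s)"
  have gG: "g s = G N s" if "Re s > - real N" for N s
  proof -
    have m: "Re s > - real (nat \<lceil>\<bar>Re s\<bar>\<rceil> + 1)" by linarith
    show ?thesis unfolding g_def
      using eq[OF _ that] eq[OF _ m] by (cases "N \<le> nat \<lceil>\<bar>Re s\<bar>\<rceil> + 1") (auto simp del: of_nat_add)
  qed
  have "g field_differentiable at z" for z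
  proof -
    define N where "N = nat \<lceil>\<bar>Re z\<bar>\<rceil> + 1"
    have z: "Re z > - real N" unfolding N_def by linarith
    have "g holomorphic_on {s. Re s > - real N}"
      using G(1)[of N] by (rule holomorphic_transform) (use gG in auto)
    thus ?thesis using z holomorphic_on_imp_differentiable_at open_halfspace_Re_gt by blast
  qed
  hence "g holomorphic_on UNIV" by (auto simp: holomorphic_on_def)
  moreover have "g s = f s" if "Re s > c" for s unfolding g_def using G(2) that by simp
  ultimately show ?thesis using that by blast
qed

section \<open>The Riemann zeta function\<close>

lemma dirichlet_series_shifted:
  fixes x :: "nat \<Rightarrow> real"
  assumes "\<And>n. x n \<ge> real (Suc n)"
  shows "(\<lambda>s. \<Sum>n. complex_of_real (x n) powr (-s)) holomorphic_on {s. Re s > 1}"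
    and "\<And>s. Re s > 1 \<Longrightarrow> summable (\<lambda>n. complex_of_real (x n) powr (-s))"
proof -
  \<comment> \<open>\<open>binrem 0 0 (of_real 0)\<close> is 1, which makes the plain Dirichlet
    series an instance of the general lemma.\<close>
  have "(\<lambda>s. \<Sum>n. of_real (x n) powr (-s) * binrem 0 0 (of_real 0)) holomorphic_on {s. Re s > 1}"
    and "\<And>s. s \<in> {s. Re s > 1} \<Longrightarrow> summable (\<lambda>n. of_real (x n) powr (-s) * binrem 0 0 (of_real 0))"
    by (rule binrem_sum_holomorphic[where U = "{s. Re s > 1}" and q = "1/2" and D = 0 and d = 1];
        use assms in \<open>auto intro!: holomorphic_intros simp: open_halfspace_Re_gt\<close>)+
  thus "(\<lambda>s. \<Sum>n. complex_of_real (x n) powr (-s)) holomorphic_on {s. Re s > 1}"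
    and "\<And>s. Re s > 1 \<Longrightarrow> summable (\<lambda>n. complex_of_real (x n) powr (-s))"
    by (auto simp: binrem_def)
qed

lemma powr_mult_binomial_expansion:
  fixes x u :: real
  assumes "x > 0" "u > -1"
  shows "complex_of_real (x * (1 + u)) powr \<alpha> =
    (\<Sum>l<L. (\<alpha> gchoose l) * (of_real x powr \<alpha> * of_real u ^ l)) + of_real x powr \<alpha> * binrem L \<alpha> (of_real u)"
proof -
  have "complex_of_real (x * (1 + u)) powr \<alpha> = of_real x powr \<alpha> * of_real (1 + u) powr \<alpha>"
    using assms by (subst of_real_mult, subst powr_times_real) auto
  thus ?thesis by (simp add: binrem_def ring_distribs sum_distrib_left mult_ac)
qed

lemma gbinomial_Suc_right:
  fixes a :: "'a :: field_char_0"
  shows "a gchoose Suc l = (a gchoose l) * (a - of_nat l) / of_nat (Suc l)"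
  by (simp add: gbinomial_prod_rev mult_ac del: of_nat_Suc)

text \<open>For \<open>Re s > 1\<close> this is \<open>zeta s - 1\<close>. Starting at 2 keeps
  \<open>u = 1 / x\<close> at most \<open>1/2\<close>, inside the disc of the binomial
  series.\<close>

definition zeta_tail :: "complex \<Rightarrow> complex" where
  "zeta_tail s = (\<Sum>n. complex_of_real (real n + 2) powr (-s))"

text \<open>Summing the binomial expansion of \<open>x\<^sup>1\<^sup>-\<^sup>s - (x+1)\<^sup>1\<^sup>-\<^sup>s\<close> over the integers \<open>x \<ge> 2\<close>, the left-hand
  side telescopes.\<close>
lemma zeta_tail_recursion:
  assumes s: "Re s > 1"
  shows "(s - 1) * zeta_tail s = 2 powr (1 - s)
    - (\<Sum>i<N. ((1 - s) gchoose Suc i) / of_nat (Suc (Suc i)) * ((s + of_nat i) * zeta_tail (s + 1 + of_nat i)))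
    + (\<Sum>n. of_real (real n + 2) powr (1 - s) * binrem (N + 2) (1 - s) (of_real (1 / (real n + 2))))"
proof -
  let ?x = "\<lambda>n::nat. real n + 2"
  let ?R = "\<lambda>n. of_real (?x n) powr (1 - s) * binrem (N + 2) (1 - s) (of_real (1 / ?x n))"
  have sumR: "summable ?R"
    by (rule binrem_sum_holomorphic(2)[where U = "{s. Re s > 1}" and q = "1/2" and D = 1 and d = 1];
        use s in \<open>auto intro!: holomorphic_intros simp: open_halfspace_Re_gt field_simps\<close>)
  have sumT: "(\<lambda>n. complex_of_real (?x n) powr (-w)) sums zeta_tail w" if "Re w > 1" for w
    using dirichlet_series_shifted(2)[of ?x w] that unfolding zeta_tail_def by (simp add: summable_sums)
  have powr_term: "complex_of_real (?x n) powr (1 - s) * of_real (1 / ?x n) ^ l = of_real (?x n) powr (-(s - 1 + of_nat l))" for n l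
  proof -
    have "of_real (1 / ?x n) ^ l = complex_of_real (?x n) powr (- of_nat l)"
      by (subst powr_minus, subst powr_nat') (auto simp: power_divide field_simps simp flip: of_real_add)
    thus ?thesis by (simp add: powr_add [symmetric] algebra_simps)
  qed
  have expand: "complex_of_real (?x (Suc n)) powr (1 - s) - complex_of_real (?x n) powr (1 - s) =
      (\<Sum>i<Suc N. ((1 - s) gchoose Suc i) * of_real (?x n) powr (-(s + of_nat i))) + ?R n" for n
  proof -
    have "?x (Suc n) = ?x n * (1 + 1 / ?x n)" by (simp add: field_simps)
    hence "complex_of_real (?x (Suc n)) powr (1 - s) =
      (\<Sum>l<N+2. ((1 - s) gchoose l) * of_real (?x n) powr (-(s - 1 + of_nat l))) + ?R n"
      using powr_mult_binomial_expansion[of "?x n" "1 / ?x n" "1 - s" "N + 2"]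
      by (simp only: powr_term) (simp add: divide_simps)
    also have "(\<Sum>l<N+2. ((1 - s) gchoose l) * of_real (?x n) powr (-(s - 1 + of_nat l))) =
      of_real (?x n) powr (1 - s) + (\<Sum>i<Suc N. ((1 - s) gchoose Suc i) * of_real (?x n) powr (-(s + of_nat i)))"
      unfolding add_2_eq_Suc' by (subst sum.lessThan_Suc_shift) (simp add: algebra_simps)
    finally show ?thesis by simp
  qed
  have lim: "(\<lambda>n. complex_of_real (?x n) powr (1 - s)) \<longlonglongrightarrow> 0"
  proof -
    have "filterlim ?x at_top sequentially" by real_asymp
    thus ?thesis using s by (intro tendsto_neg_powr_complex_of_real) auto
  qed
  have "(\<lambda>n. complex_of_real (?x (Suc n)) powr (1 - s) - complex_of_real (?x n) powr (1 - s)) sums (0 - of_real (?x 0) powr (1 - s))"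
    by (rule telescope_sums[OF lim])
  moreover have "(\<lambda>n. (\<Sum>i<Suc N. ((1 - s) gchoose Suc i) * of_real (?x n) powr (-(s + of_nat i))) + ?R n) sums
     ((\<Sum>i<Suc N. ((1 - s) gchoose Suc i) * zeta_tail (s + of_nat i)) + suminf ?R)"
    using s sumR by (intro sums_add sums_sum sums_mult sumT summable_sums) auto
  ultimately have "- (2 powr (1 - s)) = (\<Sum>i<Suc N. ((1 - s) gchoose Suc i) * zeta_tail (s + of_nat i)) + suminf ?R"
    unfolding expand by (simp add: sums_iff)
  also have "(\<Sum>i<Suc N. ((1 - s) gchoose Suc i) * zeta_tail (s + of_nat i)) =
     (1 - s) * zeta_tail s + (\<Sum>i<N. ((1 - s) gchoose Suc (Suc i)) * zeta_tail (s + 1 + of_nat i))"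
    by (subst sum.lessThan_Suc_shift) (simp add: algebra_simps)
  \<comment> \<open>The last factor of the binomial coefficient is \<open>-(s + i)\<close>. Pairing
    it with \<open>zeta_tail w\<close> at \<open>w = s + 1 + i\<close> produces the pole-free
    combination \<open>(w - 1) * zeta_tail w\<close>.\<close>
  also have "(\<Sum>i<N. ((1 - s) gchoose Suc (Suc i)) * zeta_tail (s + 1 + of_nat i)) =
     - (\<Sum>i<N. ((1 - s) gchoose Suc i) / of_nat (Suc (Suc i)) * ((s + of_nat i) * zeta_tail (s + 1 + of_nat i)))"
    unfolding sum_negf [symmetric]
    by (intro sum.cong refl, subst gbinomial_Suc_right) (simp add: divide_simps, simp add: algebra_simps)
  finally have "- (2 powr (1 - s)) = (1 - s) * zeta_tail s +
     - (\<Sum>i<N. ((1 - s) gchoose Suc i) / of_nat (Suc (Suc i)) * ((s + of_nat i) * zeta_tail (s + 1 + of_nat i))) + suminf ?R" .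
  moreover have "(s - 1) * a = b - c + d" if "- b = (1 - s) * a + - c + d" for a b c d
  proof -
    have "b = - ((1 - s) * a + - c + d)" using that by (metis minus_minus)
    thus ?thesis by (simp add: algebra_simps)
  qed
  ultimately show ?thesis by blast
qed

text \<open>The right-hand side of the recursion involves \<open>(w - 1) * zeta_tail w\<close> only
  at \<open>w = s + 1, s + 2, ...\<close>, so each induction step moves the boundary one unit to the
  left. At \<open>s = 1\<close> its binomial coefficients and its remainder vanish, leaving
  \<open>2 powr 0 = 1\<close>.\<close>

lemma zeta_tail_half_plane:
  "\<exists>g. g holomorphic_on {s. Re s > 1 - real N} \<and> (\<forall>s. Re s > 1 \<longrightarrow> g s = (s - 1) * zeta_tail s) \<and>
       (N > 0 \<longrightarrow> g 1 = 1)"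
proof (induction N)
  case 0
  have "zeta_tail holomorphic_on {s. Re s > 1}"
    unfolding zeta_tail_def using dirichlet_series_shifted(1)[of "\<lambda>n. real n + 2"] by simp
  thus ?case by (intro exI[of _ "\<lambda>s. (s - 1) * zeta_tail s"]) (auto intro!: holomorphic_intros)
next
  case (Suc N)
  then obtain g where g: "g holomorphic_on {s. Re s > 1 - real N}" "\<And>s. Re s > 1 \<Longrightarrow> g s = (s - 1) * zeta_tail s"
    by blast
  let ?U = "{s. Re s > 1 - real (Suc N)}"
  let ?R = "\<lambda>s. \<Sum>n. of_real (real n + 2) powr (1 - s) * binrem (N + 2) (1 - s) (of_real (1 / (real n + 2)))"
  define h where "h = (\<lambda>s. 2 powr (1 - s) - (\<Sum>i<N. ((1 - s) gchoose Suc i) / of_nat (Suc (Suc i)) * g (s + 1 + of_nat i)) + ?R s)"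
  \<comment> \<open>With \<open>N + 2\<close> terms cut off, the condition is
    \<open>Re (1 - s) < N + 1\<close>, which describes exactly the new half-plane.\<close>
  have R: "?R holomorphic_on ?U"
    by (rule binrem_sum_holomorphic(1)[where q = "1/2" and D = 1 and d = 1];
        auto intro!: holomorphic_intros simp: open_halfspace_Re_gt field_simps)
  have gh: "(\<lambda>s. g (s + 1 + of_nat i)) holomorphic_on ?U" for i
  proof -
    have "(g \<circ> (\<lambda>s. s + 1 + of_nat i)) holomorphic_on ?U"
      by (rule holomorphic_on_compose_gen[OF _ g(1)]) (auto intro!: holomorphic_intros)
    thus ?thesis by (simp add: o_def)
  qed
  have "h holomorphic_on ?U" unfolding h_def gbinomial_prod_rev
    by (intro holomorphic_intros gh R) auto
  moreover have "h s = (s - 1) * zeta_tail s" if "Re s > 1" for s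
  proof -
    have "g (s + 1 + of_nat i) = (s + of_nat i) * zeta_tail (s + 1 + of_nat i)" for i
      using that by (subst g(2)) auto
    thus ?thesis unfolding h_def zeta_tail_recursion[OF that, of N] by simp
  qed
  moreover have "h 1 = 1"
  proof -
    have "binrem (N + 2) 0 (of_real (1 / (real n + 2))) = 0" for n
    proof -
      have "norm (complex_of_real (1 / (real n + 2))) < 1" by (subst norm_of_real) simp
      from binrem_of_nat[OF _ this, of 0 "N + 2"] show ?thesis by simp
    qed
    moreover have "(0 :: complex) gchoose Suc i = 0" for i using binomial_gbinomial[of 0 "Suc i", where 'a = complex] by simp
    ultimately show ?thesis by (simp add: h_def)
  qed
  ultimately show ?case by auto
qed

text \<open>Supplies the normalised meromorphic functions that
  \<open>meromorphic_continuation_eqI\<close> asks for: both zeta functions are obtained as entire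
  functions divided by a polynomial.\<close>

lemma remove_sings_quotient:
  assumes "G holomorphic_on UNIV" "Q holomorphic_on UNIV"
  shows "remove_sings (\<lambda>s. G s / Q s) nicely_meromorphic_on UNIV"
    and "\<And>s. Q s \<noteq> 0 \<Longrightarrow> remove_sings (\<lambda>s. G s / Q s) s = G s / Q s"
proof -
  have an: "G analytic_on A" "Q analytic_on A" for A
    using assms by (auto simp: analytic_on_open intro: analytic_on_subset[of _ UNIV])
  show "remove_sings (\<lambda>s. G s / Q s) nicely_meromorphic_on UNIV"
    by (intro remove_sings_nicely_meromorphic meromorphic_intros analytic_on_imp_meromorphic_on an)
  show "remove_sings (\<lambda>s. G s / Q s) s = G s / Q s" if "Q s \<noteq> 0" for s
    using that by (intro remove_sings_at_analytic analytic_intros an) auto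
qed

text \<open>\<open>G\<close> is \<open>(s - 1) * zeta s\<close> with the singularity filled in. The
  residue \<open>G 1 = 1\<close> is what produces the Gamma quotients in the end.\<close>

lemma zeta_entire:
  obtains G where "G holomorphic_on UNIV" "G 1 = 1" "\<And>s. s \<noteq> 1 \<Longrightarrow> zeta s = G s / (s - 1)"
    "\<And>s. Re s > 1 \<Longrightarrow> (\<lambda>n. complex_of_real (real (Suc n)) powr (-s)) sums zeta s"
proof -
  have ex: "\<exists>g. g holomorphic_on {s. Re s > - real N} \<and> (\<forall>s. Re s > 1 \<longrightarrow> g s = (s - 1) * zeta_tail s)" for N
    using zeta_tail_half_plane[of "Suc N"] by auto
  obtain g where g: "g holomorphic_on UNIV" "\<And>s. Re s > 1 \<Longrightarrow> g s = (s - 1) * zeta_tail s"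
    using entire_from_half_planes[of 1 "\<lambda>s. (s - 1) * zeta_tail s", OF ex] by blast
  \<comment> \<open>The glued function \<open>g\<close> is only known for \<open>Re s > 1\<close>;
    its value at 1 comes from comparison with a continuation whose value there is known.\<close>
  obtain g1 where g1: "g1 holomorphic_on {s. Re s > 0}" "\<And>s. Re s > 1 \<Longrightarrow> g1 s = (s - 1) * zeta_tail s" "g1 1 = 1"
    using zeta_tail_half_plane[of 1] by auto
  have "g 1 = g1 1"
  proof (rule half_plane_eqI[where f = g and g = g1 and c = 1 and d = 0])
    show "g holomorphic_on {s. Re s > 0}" using g(1) by (rule holomorphic_on_subset) auto
  qed (use g(2) g1 in auto)
  \<comment> \<open>The summand \<open>s - 1\<close> restores the first term 1 of the zeta series,
    multiplied by \<open>s - 1\<close>.\<close>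
  define G where "G = (\<lambda>s. g s + (s - 1))"
  have G: "G holomorphic_on UNIV" unfolding G_def by (intro holomorphic_intros g)
  have sums: "(\<lambda>n. complex_of_real (real (Suc n)) powr (-s)) sums (zeta_tail s + 1)" if "Re s > 1" for s
  proof -
    have "(\<lambda>n. complex_of_real (real (Suc (Suc n))) powr (-s)) sums zeta_tail s"
      using dirichlet_series_shifted(2)[of "\<lambda>n. real n + 2" s] that
      unfolding zeta_tail_def by (simp add: summable_sums add.commute)
    from sums_Suc[OF this] show ?thesis by simp
  qed
  have eq: "zeta = remove_sings (\<lambda>s. G s / (s - 1))"
    unfolding zeta_def
  proof (rule meromorphic_continuation_eqI)
    show "remove_sings (\<lambda>s. G s / (s - 1)) nicely_meromorphic_on UNIV"
      by (intro remove_sings_quotient G holomorphic_intros)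
    fix s :: complex assume s: "Re s > 1"
    have "remove_sings (\<lambda>s. G s / (s - 1)) s = G s / (s - 1)"
      using s by (intro remove_sings_quotient G holomorphic_intros) auto
    also have "\<dots> = (s - 1) * (zeta_tail s + 1) / (s - 1)"
      using g(2)[OF s] by (simp add: G_def algebra_simps)
    also have "\<dots> = zeta_tail s + 1" using s by auto
    also have "\<dots> = (\<Sum>n. 1 / of_nat (Suc n) powr s)"
      using sums[OF s] by (simp add: sums_iff powr_minus divide_inverse)
    finally show "remove_sings (\<lambda>s. G s / (s - 1)) s = (\<Sum>n. 1 / of_nat (Suc n) powr s)" .
  qed
  have z: "zeta s = G s / (s - 1)" if "s \<noteq> 1" for s
    unfolding eq using that by (intro remove_sings_quotient G holomorphic_intros) auto
  have z1: "(\<lambda>n. complex_of_real (real (Suc n)) powr (-s)) sums zeta s" if "Re s > 1" for s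
  proof -
    have s1: "s \<noteq> 1" using that by auto
    hence "zeta s = (s - 1) * (zeta_tail s + 1) / (s - 1)"
      using z[OF s1] g(2)[OF that] by (simp add: G_def algebra_simps)
    hence "zeta s = zeta_tail s + 1" using s1 by simp
    thus ?thesis using sums[OF that] by simp
  qed
  show ?thesis by (rule that[OF G _ z z1]) (use \<open>g 1 = g1 1\<close> g1(3) in \<open>auto simp: G_def\<close>)
qed

section \<open>Sums over half-integers\<close>

text \<open>The even integers contribute \<open>2 powr (-s) * zeta s\<close> to the zeta series.
  What remains belongs to the odd integers, and halving these multiplies the sum by
  \<open>2 powr s\<close>.\<close>

lemma odd_half_sums:
  assumes "Re s > 1"
  shows "(\<lambda>n. complex_of_real (real n + real K + 1/2) powr (-s)) sums
     ((2 powr s - 1) * zeta s - (\<Sum>i<K. complex_of_real (real i + 1/2) powr (-s)))"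
proof -
  define f where "f = (\<lambda>n. complex_of_real (real (Suc n)) powr (-s))"
  have f: "f sums zeta s" unfolding f_def using assms zeta_entire by metis
  have "(\<lambda>n. sum f {n * 2..<n * 2 + 2}) sums zeta s" by (rule sums_group[OF f]) auto
  also have "(\<lambda>n. sum f {n * 2..<n * 2 + 2}) = (\<lambda>n. f (2 * n) + f (2 * n + 1))"
    by (auto simp: numeral_2_eq_2 mult.commute)
  finally have 1: "(\<lambda>n. f (2 * n) + f (2 * n + 1)) sums zeta s" .
  \<comment> \<open>\<open>f n\<close> belongs to the integer \<open>n + 1\<close>, so odd indices
    stand for even integers.\<close>
  have "f (2 * n + 1) = 2 powr (-s) * f n" for n
  proof -
    have "f (2 * n + 1) = complex_of_real (2 * real (Suc n)) powr (-s)" by (simp add: f_def)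
    also have "\<dots> = 2 powr (-s) * f n" unfolding f_def
      by (subst of_real_mult, subst powr_times_real) auto
    finally show ?thesis .
  qed
  hence 2: "(\<lambda>n. f (2 * n + 1)) sums (2 powr (-s) * zeta s)" using sums_mult[OF f] by simp
  have 3: "f (2 * n) = 2 powr (-s) * complex_of_real (real n + 1/2) powr (-s)" for n
  proof -
    have "f (2 * n) = complex_of_real (2 * (real n + 1/2)) powr (-s)" by (simp add: f_def add.commute)
    also have "\<dots> = 2 powr (-s) * complex_of_real (real n + 1/2) powr (-s)"
      by (subst of_real_mult, subst powr_times_real) auto
    finally show ?thesis .
  qed
  have "(\<lambda>n. 2 powr (-s) * complex_of_real (real n + 1/2) powr (-s)) sums (zeta s - 2 powr (-s) * zeta s)"
    using sums_diff[OF 1 2] by (simp add: 3)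
  from sums_mult[OF this, of "2 powr s"]
  have "(\<lambda>n. complex_of_real (real n + 1/2) powr (-s)) sums ((2 powr s - 1) * zeta s)"
    by (simp add: powr_minus right_diff_distrib left_diff_distrib flip: mult.assoc)
  from sums_split_initial_segment[OF this, of K] show ?thesis by (simp add: add_ac)
qed

section \<open>The polynomial \<open>P\<close>\<close>

text \<open>The product is \<open>y * (y + 1) * ... * (y + n)\<close> without its first factor,
  hence the shifted Stirling indices. Induction along the Stirling recurrence avoids a division by
  \<open>y\<close>.\<close>

lemma prod_shift_stirling:
  fixes y :: "'a :: comm_ring_1"
  shows "(\<Prod>i<n. y + 1 + of_nat i) = (\<Sum>m\<le>n. of_nat (stirling (Suc n) (Suc m)) * y ^ m)"
proof (induction n)
  case (Suc n)
  let ?S = "\<lambda>m. of_nat (stirling (Suc n) m) :: 'a"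
  have "(\<Sum>m\<le>Suc n. of_nat (stirling (Suc (Suc n)) (Suc m)) * y ^ m) =
      of_nat (Suc n) * (\<Sum>m\<le>Suc n. ?S (Suc m) * y ^ m) + (\<Sum>m\<le>Suc n. ?S m * y ^ m)"
    unfolding sum_distrib_left sum.distrib [symmetric]
    by (intro sum.cong refl) (simp add: algebra_simps)
  also have "(\<Sum>m\<le>Suc n. ?S m * y ^ m) = y * (\<Sum>m\<le>n. ?S (Suc m) * y ^ m)"
    by (subst sum.atMost_Suc_shift) (simp add: sum_distrib_left algebra_simps del: stirling.simps)
  also have "(\<Sum>m\<le>Suc n. ?S (Suc m) * y ^ m) = (\<Sum>m\<le>n. ?S (Suc m) * y ^ m)"
    by (simp add: stirling_less del: stirling.simps)
  finally show ?case unfolding prod.lessThan_Suc Suc.IH by (simp add: algebra_simps del: stirling.simps)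
qed simp

text \<open>With \<open>y = x - a\<close> one has \<open>2 * x = y + (y + k - 1)\<close>. This
  splits the right-hand side into two rising factorials, whose coefficients are the two Stirling
  numbers in \<open>B\<close>; re-expanding \<open>y ^ m\<close> in powers of \<open>x\<close> gives
  the rest.\<close>

lemma sum_B:
  fixes x :: complex
  assumes k: "k \<ge> 2"
  defines "a \<equiv> of_nat (k - 1) / 2"
  shows "(\<Sum>j<k. B k j * x ^ j) = 2 * x * (\<Prod>i=1..k-2. x - a + of_nat i)"
proof -
  define y where "y = x - a"
  define c :: "nat \<Rightarrow> complex" where "c = (\<lambda>m. of_nat (stirling (k - 1) m + stirling k (Suc m)))"
  obtain r where r: "k = Suc (Suc r)" using k by (metis add_2_eq_Suc le_Suc_ex)
  have 1: "(\<Prod>i<k-1. y + of_nat i) = y * (\<Prod>i=1..k-2. y + of_nat i)"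
    by (simp add: r prod.lessThan_Suc_shift prod.atLeast1_atMost_eq del: prod.lessThan_Suc)
  have 2: "(\<Prod>i<k-1. y + 1 + of_nat i) = (\<Prod>i=1..k-2. y + of_nat i) * (y + of_nat (k - 1))"
    by (simp add: r prod.atLeast1_atMost_eq algebra_simps)
  have "2 * x = y + (y + of_nat (k - 1))" by (simp add: y_def a_def)
  hence "2 * x * (\<Prod>i=1..k-2. y + of_nat i) = (\<Prod>i<k-1. y + of_nat i) + (\<Prod>i<k-1. y + 1 + of_nat i)"
    unfolding 1 2 by (simp only: ring_distribs) (simp add: mult_ac)
  also have "(\<Prod>i<k-1. y + of_nat i) = (\<Sum>m\<le>k-1. of_nat (stirling (k - 1) m) * y ^ m)"
    using stirling_pochhammer[of "k - 1" y] by (simp add: pochhammer_prod atLeast0LessThan)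
  also have "(\<Prod>i<k-1. y + 1 + of_nat i) = (\<Sum>m\<le>k-1. of_nat (stirling k (Suc m)) * y ^ m)"
    using prod_shift_stirling[where n = "k - 1" and y = y] k by simp
  also have "(\<Sum>m\<le>k-1. of_nat (stirling (k - 1) m) * y ^ m) + \<dots> = (\<Sum>m<k. c m * y ^ m)"
    unfolding sum.distrib [symmetric] by (rule sum.cong) (use k in \<open>auto simp: c_def algebra_simps\<close>)
  also have "\<dots> = (\<Sum>m<k. \<Sum>j\<le>m. c m * of_nat (m choose j) * x ^ j * (-a) ^ (m - j))"
  proof (intro sum.cong refl)
    fix m
    have "y ^ m = (\<Sum>j\<le>m. of_nat (m choose j) * x ^ j * (-a) ^ (m - j))"
      unfolding y_def by (subst diff_conv_add_uminus, subst binomial_ring) simp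
    thus "c m * y ^ m = (\<Sum>j\<le>m. c m * of_nat (m choose j) * x ^ j * (-a) ^ (m - j))"
      by (simp add: sum_distrib_left mult_ac)
  qed
  \<comment> \<open>Writing \<open>m\<close> as \<open>j + (m - j)\<close> prepares the change of
    summation to pairs \<open>(j, p)\<close> with \<open>p = m - j\<close>.\<close>
  also have "\<dots> = (\<Sum>m<k. \<Sum>j\<le>m. c (j + (m - j)) * of_nat ((j + (m - j)) choose j) * x ^ j * (-a) ^ (m - j))"
    by simp
  also have "\<dots> = (\<Sum>(j,p)\<in>{(j,p). j + p < k}. c (j + p) * of_nat ((j + p) choose j) * x ^ j * (-a) ^ p)"
    by (rule sum.triangle_reindex [symmetric])
  also have "{(j,p). j + p < k} = Sigma {..<k} (\<lambda>j. {0..k - j - 1})" by auto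
  also have "(\<Sum>(j,p)\<in>\<dots>. c (j + p) * of_nat ((j + p) choose j) * x ^ j * (-a) ^ p) =
      (\<Sum>j<k. \<Sum>p=0..k-j-1. c (j + p) * of_nat ((j + p) choose j) * x ^ j * (-a) ^ p)"
    by (subst sum.Sigma) auto
  also have "\<dots> = (\<Sum>j<k. B k j * x ^ j)"
    unfolding B_def sum_distrib_right
  proof (intro sum.cong refl)
    fix j p
    \<comment> \<open>Both signed Stirling numbers carry the sign
      \<open>(-1) ^ (k + j + p + 1)\<close>, so only \<open>(-1) ^ p\<close> survives.\<close>
    have "(-1) ^ (k + j + 1) * of_int (stirling1 k (j + p + 1) + stirling1 (k - 1) (j + p)) = (-1) ^ p * c (j + p)"
      by (simp add: stirling1_def c_def r power_add algebra_simps flip: power_mult_distrib del: stirling.simps)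
    hence "a ^ p * ((-1) ^ (k + j + 1) * of_int (stirling1 k (j + p + 1) + stirling1 (k - 1) (j + p))) = c (j + p) * (-a) ^ p"
      by (simp add: power_minus[of a])
    thus "c (j + p) * of_nat ((j + p) choose j) * x ^ j * (-a) ^ p =
      (-1) ^ (k + j + 1) * of_nat ((j + p) choose j) * (of_nat (k - 1) / 2) ^ p *
      of_int (stirling1 k (j + p + 1) + stirling1 (k - 1) (j + p)) * x ^ j"
      unfolding a_def by (simp only: mult_ac)
  qed
  finally show ?thesis by (simp add: y_def)
qed

text \<open>Since \<open>2 * a = 2 * K - 1\<close>, the reflection of \<open>i\<close> to
  \<open>2 * K - 1 - i\<close> together with the even number of factors shows that the product in
  \<open>sum_B\<close> is even in \<open>x\<close>. The factor \<open>2 * x\<close> makes the whole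
  polynomial odd.\<close>

lemma B_even_eq_0:
  assumes K: "K \<ge> 1" and j: "even j" "j < 2 * K"
  shows "B (2 * K) j = 0"
proof -
  define a :: complex where "a = of_nat (2 * K - 1) / 2"
  have odd: "(\<Prod>i=1..2*K-2. - x - a + of_nat i) = (\<Prod>i=1..2*K-2. x - a + of_nat i)" for x :: complex
  proof -
    have "(\<Prod>i=1..2*K-2. - x - a + of_nat i) = (\<Prod>i=1..2*K-2. (-1) * (x + a - of_nat i))"
      by (intro prod.cong) auto
    also have "\<dots> = (\<Prod>i=1..2*K-2. x + a - of_nat i)"
      by (subst prod.distrib) simp
    also have "\<dots> = (\<Prod>i=1..2*K-2. x - a + of_nat i)"
      by (rule prod.reindex_bij_witness[of _ "\<lambda>i. 2 * K - 1 - i" "\<lambda>i. 2 * K - 1 - i"])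
         (auto simp: a_def of_nat_diff field_simps)
    finally show ?thesis .
  qed
  have "(\<Sum>j\<le>2*K-1. (B (2 * K) j * (-1) ^ j) * x ^ j) = (\<Sum>j\<le>2*K-1. (- B (2 * K) j) * x ^ j)" for x
  proof -
    have set: "{..2*K-1} = {..<2*K}" using K by auto
    have "(\<Sum>j\<le>2*K-1. (B (2 * K) j * (-1) ^ j) * x ^ j) = (\<Sum>j<2*K. B (2 * K) j * (- x) ^ j)"
      unfolding set by (intro sum.cong refl) (simp add: power_minus[of x])
    also have "\<dots> = - (\<Sum>j<2*K. B (2 * K) j * x ^ j)"
      using K odd[of x] by (simp add: sum_B a_def)
    finally show ?thesis unfolding set by (simp add: sum_negf)
  qed
  hence "\<forall>j\<le>2*K-1. B (2 * K) j * (-1) ^ j = - B (2 * K) j"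
    using polyfun_eq_coeffs[where n = "2 * K - 1" and c = "\<lambda>j. B (2 * K) j * (-1) ^ j" and d = "\<lambda>j. - B (2 * K) j"] by blast
  hence "B (2 * K) j * (-1) ^ j = - B (2 * K) j" using j(2) by simp
  thus ?thesis using j by (simp add: eq_neg_iff_add_eq_0)
qed

lemma sum_B_odd:
  fixes x :: complex
  assumes K: "K \<ge> 1"
  shows "(\<Sum>m=1..K. B (2 * K) (2 * m - 1) * x ^ (2 * m - 1)) =
    2 * x * (\<Prod>i=1..2*K-2. x - of_real (real K - 1/2) + of_nat i)"
proof -
  have "(\<Sum>m=1..K. B (2 * K) (2 * m - 1) * x ^ (2 * m - 1)) = (\<Sum>j\<in>{j. j < 2 * K \<and> odd j}. B (2 * K) j * x ^ j)"
    by (rule sum.reindex_bij_witness[of _ "\<lambda>j. (j + 1) div 2" "\<lambda>m. 2 * m - 1"]) (auto elim!: oddE)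
  also have "\<dots> = (\<Sum>j<2*K. B (2 * K) j * x ^ j)"
    by (rule sum.mono_neutral_left) (use K B_even_eq_0 in auto)
  also have "\<dots> = 2 * x * (\<Prod>i=1..2*K-2. x - of_nat (2 * K - 1) / 2 + of_nat i)"
    using K by (subst sum_B) auto
  also have "complex_of_nat (2 * K - 1) / 2 = of_real (real K - 1/2)"
    using K by (simp add: of_nat_diff field_simps)
  finally show ?thesis .
qed

lemma P_eq_sum_B:
  assumes K: "K \<ge> 1"
  shows "P (2 * K) n = (\<Sum>m=1..K. B (2 * K) (2 * m - 1) * of_real (real n + real K - 1/2) ^ (2 * m - 1)) / fact (2 * K - 1)"
proof -
  have "complex_of_nat (2 * n + 2 * K - 1) = 2 * of_real (real n + real K - 1/2)"
    using K by (simp add: of_nat_diff algebra_simps)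
  thus ?thesis unfolding P_def sum_B_odd[OF K] by simp
qed

text \<open>The points \<open>1/2, 3/2, \<dots>, K - 3/2\<close> are roots of \<open>P\<close> (shifted), and at the remaining point
  \<open>K - 1/2\<close> the power vanishes unless \<open>n = 0\<close>.\<close>
lemma sum_B_at_half_integers:
  assumes K: "K \<ge> 1"
  shows "(\<Sum>i<K. (\<Sum>m=1..K. B (2 * K) (2 * m - 1) * of_real (real i + 1/2) ^ (2 * m - 1)) *
           of_real ((real i + 1/2)\<^sup>2 - (real K - 1/2)\<^sup>2) ^ n) = (if n = 0 then fact (2 * K - 1) else 0)"
    (is "(\<Sum>i<K. ?f i) = _")
proof -
  have zero: "?f i = 0" if i: "i < K - 1" for i
  proof -
    have "(\<Prod>j=1..2*K-2. complex_of_real (real i + 1/2) - of_real (real K - 1/2) + of_nat j) = 0"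
      using i by (intro prod_zero bexI[of _ "K - 1 - i"]) (auto simp: of_nat_diff)
    thus ?thesis unfolding sum_B_odd[OF K] by simp
  qed
  have last: "?f (K - 1) = (if n = 0 then fact (2 * K - 1) else 0)"
  proof -
    have K1: "real (K - 1) + 1/2 = real K - 1/2" using K by (simp add: of_nat_diff)
    \<comment> \<open>This is \<open>P (2 * K) 0 = 1\<close> with the denominator cleared, the
      source of the summand \<open>-1\<close> in \<open>Z k 0\<close>.\<close>
    have "2 * complex_of_real (real K - 1/2) * (\<Prod>i=1..2*K-2. of_nat i) = of_nat (2 * K - 1) * fact (2 * K - 2)"
      using K by (simp add: fact_prod of_nat_diff algebra_simps)
    also have "\<dots> = fact (2 * K - 1)" using K fact_reduce[of "2 * K - 1", where 'a = complex]
      by (simp add: numeral_2_eq_2)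
    finally show ?thesis unfolding sum_B_odd[OF K] K1 by simp
  qed
  have "{..<K} = insert (K - 1) {..<K - 1}" using K by auto
  hence "(\<Sum>i<K. ?f i) = ?f (K - 1) + (\<Sum>i<K-1. ?f i)" by simp
  also have "(\<Sum>i<K-1. ?f i) = 0" by (intro sum.neutral ballI zero) auto
  finally show ?thesis unfolding last by simp
qed

section \<open>The zeta function of an even-dimensional sphere\<close>

text \<open>For \<open>Re w > 1\<close> this is the Hurwitz zeta function \<open>\<Sum>n. (n + K + 1/2) powr (-w)\<close>.\<close>
definition half_zeta :: "nat \<Rightarrow> complex \<Rightarrow> complex" where
  "half_zeta K w = (2 powr w - 1) * zeta w - (\<Sum>i<K. complex_of_real (real i + 1/2) powr (-w))"

text \<open>As \<open>2 powr w - 1\<close> equals 1 at \<open>w = 1\<close>, the pole of zeta keeps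
  its residue 1. The point \<open>w = 1\<close> is exempt because the factor \<open>w - 1\<close>
  makes the product 0 there.\<close>

lemma half_zeta_entire:
  obtains E where "E holomorphic_on UNIV" "E 1 = 1" "\<And>w. E w = (w - 1) * half_zeta K w \<or> w = 1"
proof -
  obtain G where G: "G holomorphic_on UNIV" "G 1 = 1" "\<And>s. s \<noteq> 1 \<Longrightarrow> zeta s = G s / (s - 1)"
    using zeta_entire by metis
  define E where "E = (\<lambda>w. (2 powr w - 1) * G w - (w - 1) * (\<Sum>i<K. complex_of_real (real i + 1/2) powr (-w)))"
  show ?thesis
  proof (rule that[of E])
    show "E holomorphic_on UNIV" unfolding E_def by (intro holomorphic_intros G) auto
    show "E 1 = 1" by (simp add: E_def G)
    show "E w = (w - 1) * half_zeta K w \<or> w = 1" for w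
      by (cases "w = 1") (auto simp: E_def half_zeta_def G(3) right_diff_distrib)
  qed
qed

section \<open>Clearing the poles of the single terms\<close>

definition pole_poly :: "nat \<Rightarrow> complex \<Rightarrow> complex" where
  "pole_poly K s = (\<Prod>i=1..K. s - of_nat i)"

text \<open>The entire function \<open>((-s) gchoose l) * pole_poly K s / (s + l - m)\<close>: the denominator cancels against
  \<open>pole_poly\<close> if \<open>l < m\<close> and against the binomial coefficient otherwise. So all poles of \<open>Z (2 * K)\<close> lie
  in \<open>{1..K}\<close>.\<close>
definition bin_quot :: "nat \<Rightarrow> nat \<Rightarrow> nat \<Rightarrow> complex \<Rightarrow> complex" where
  "bin_quot K m l s =
     (if l < m then ((-s) gchoose l) * (\<Prod>i\<in>{1..K} - {m - l}. s - of_nat i)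
      else - pole_poly K s * (\<Prod>i\<in>{..<l} - {l - m}. - s - of_nat i) / fact l)"

lemma bin_quot:
  assumes "1 \<le> m" "m \<le> K"
  shows "bin_quot K m l s * (s + of_nat l - of_nat m) = ((-s) gchoose l) * pole_poly K s"
proof (cases "l < m")
  case True
  have "pole_poly K s = (s - of_nat (m - l)) * (\<Prod>i\<in>{1..K} - {m - l}. s - of_nat i)"
    unfolding pole_poly_def using True assms by (intro prod.remove) auto
  moreover have "s + of_nat l - of_nat m = s - of_nat (m - l)" using True by (simp add: of_nat_diff)
  ultimately show ?thesis using True by (simp add: bin_quot_def mult_ac)
next
  case False
  have "(\<Prod>i<l. - s - of_nat i) = (- s - of_nat (l - m)) * (\<Prod>i\<in>{..<l} - {l - m}. - s - of_nat i)"
    using False assms by (intro prod.remove) auto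
  hence "((-s) gchoose l) = - (s + of_nat l - of_nat m) * (\<Prod>i\<in>{..<l} - {l - m}. - s - of_nat i) / fact l"
    using False by (simp add: gbinomial_prod_rev atLeast0LessThan of_nat_diff algebra_simps)
  moreover have "- q * p / f * b = - b * p / f * q" for q p f b :: complex by simp
  ultimately show ?thesis using False unfolding bin_quot_def by (simp only: if_False)
qed

lemma bin_quot_holomorphic: "bin_quot K m l holomorphic_on A"
proof (cases "l < m")
  case True
  hence "bin_quot K m l = (\<lambda>s. ((-s) gchoose l) * (\<Prod>i\<in>{1..K} - {m - l}. s - of_nat i))"
    by (auto simp: bin_quot_def)
  thus ?thesis by (auto simp: gbinomial_prod_rev intro!: holomorphic_intros)
next
  case False
  hence "bin_quot K m l = (\<lambda>s. - pole_poly K s * (\<Prod>i\<in>{..<l} - {l - m}. - s - of_nat i) / fact l)"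
    by (auto simp: bin_quot_def)
  thus ?thesis by (auto simp: pole_poly_def intro!: holomorphic_intros)
qed

text \<open>At \<open>s = -n\<close> the factor of the binomial coefficient with index
  \<open>n\<close> is the one that has been cancelled. The factors before it multiply to
  \<open>n!\<close>, those after it to \<open>(m - 1)!\<close> up to sign.\<close>

lemma bin_quot_at_pole:
  assumes m: "1 \<le> m"
  shows "bin_quot K m (n + m) (- of_nat n) =
    (-1) ^ m * (fact n * fact (m - 1) / fact (n + m)) * pole_poly K (- of_nat n)"
proof -
  have "(\<Prod>i\<in>{..<n+m} - {n}. complex_of_nat n - of_nat i) =
      (\<Prod>i<n. of_nat n - of_nat i) * (\<Prod>i\<in>{Suc n..<n+m}. of_nat n - of_nat i)"
    by (subst prod.union_disjoint [symmetric]) (use m in \<open>auto intro!: prod.cong\<close>)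
  also have "(\<Prod>i<n. complex_of_nat n - of_nat i) = (\<Prod>i=1..n. of_nat i)"
    by (rule prod.reindex_bij_witness[of _ "\<lambda>i. n - i" "\<lambda>i. n - i"]) (auto simp: of_nat_diff)
  also have "\<dots> = fact n" by (simp add: fact_prod)
  also have "(\<Prod>i\<in>{Suc n..<n+m}. complex_of_nat n - of_nat i) = (\<Prod>i=1..m-1. (-1) * of_nat i)"
    by (rule prod.reindex_bij_witness[of _ "\<lambda>i. n + i" "\<lambda>i. i - n"]) (auto simp: of_nat_diff)
  also have "\<dots> = (-1) ^ (m - 1) * fact (m - 1)"
    by (subst prod.distrib) (simp add: fact_prod)
  finally have "bin_quot K m (n + m) (- of_nat n) = - pole_poly K (- of_nat n) * (fact n * ((-1) ^ (m - 1) * fact (m - 1))) / fact (n + m)"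
    using m by (simp add: bin_quot_def)
  moreover have "(-1) ^ m = - ((-1) ^ (m - 1) :: complex)" using m by (cases m) auto
  ultimately show ?thesis by simp
qed

lemma pole_poly_neg_nonzero: "pole_poly K (- of_nat n) \<noteq> 0"
proof -
  have "- of_nat n - of_nat i \<noteq> (0 :: complex)" if "i \<ge> 1" for i
  proof -
    have "- of_nat n - of_nat i = - complex_of_nat (n + i)" by simp
    thus ?thesis using that by (metis add_is_0 neg_equal_0_iff_equal not_one_le_zero of_nat_eq_0_iff)
  qed
  thus ?thesis by (auto simp: pole_poly_def)
qed

section \<open>Expansion of the series of the sphere\<close>

text \<open>The remainder belonging to the monomial \<open>x ^ (2 * m - 1)\<close> of
  \<open>P\<close>. The index \<open>n\<close> stands for the integer \<open>n + 1\<close>, whose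
  \<open>x\<close> is \<open>n + K + 1/2\<close>.\<close>

definition Z_rem :: "nat \<Rightarrow> nat \<Rightarrow> nat \<Rightarrow> complex \<Rightarrow> complex" where
  "Z_rem K m L s = (\<Sum>n. of_real (real n + real K + 1/2) powr (2 * of_nat m - 1 - 2 * s) *
      binrem L (- s) (of_real (- ((real K - 1/2) / (real n + real K + 1/2))\<^sup>2)))"

lemma Z_rem:
  assumes K: "K \<ge> 1" and m: "m \<le> K"
  shows "Z_rem K m L holomorphic_on {s. Re s > real K - real L}"
    and "\<And>s. Re s > real K - real L \<Longrightarrow> summable (\<lambda>n. of_real (real n + real K + 1/2) powr (2 * of_nat m - 1 - 2 * s) *
      binrem L (- s) (of_real (- ((real K - 1/2) / (real n + real K + 1/2))\<^sup>2)))"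
proof -
  \<comment> \<open>\<open>?q\<close> is the largest absolute value of the binomial argument,
    attained at \<open>n = 0\<close>.\<close>
  let ?U = "{s. Re s > real K - real L}" and ?q = "((real K - 1/2) / (real K + 1/2))\<^sup>2"
    and ?x = "\<lambda>n::nat. real n + real K + 1/2"
  have ge: "?x n \<ge> real (Suc n)" for n using K by simp
  have r: "0 < (real K - 1/2) / (real K + 1/2)" "(real K - 1/2) / (real K + 1/2) < 1"
    using K by (auto simp: field_simps)
  have q: "0 < ?q" by (rule zero_less_power[OF r(1)])
  have q': "?q < 1" using power_strict_mono[OF r(2) less_imp_le[OF r(1)], of 2] by simp
  have u: "\<bar>- ((real K - 1/2) / ?x n)\<^sup>2\<bar> \<le> ?q" for n
    using K by (auto intro!: power_mono divide_left_mono)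
  have u': "\<bar>- ((real K - 1/2) / ?x n)\<^sup>2\<bar> \<le> (real K - 1/2)\<^sup>2 / ?x n ^ 2" for n
    by (simp add: power_divide)
  have w: "(\<lambda>s. 2 * of_nat m - 1 - 2 * s) holomorphic_on ?U" "(\<lambda>s. - s) holomorphic_on ?U"
    by (auto intro!: holomorphic_intros)
  have less: "Re (2 * of_nat m - 1 - 2 * s) < real 2 * real L - 1" if "s \<in> ?U" for s
    using that m by simp
  have "open ?U" by (rule open_halfspace_Re_gt)
  note * = binrem_sum_holomorphic[OF this w ge q q' u u' less]
  show "Z_rem K m L holomorphic_on ?U" unfolding Z_rem_def using *(1) .
  show "summable (\<lambda>n. of_real (?x n) powr (2 * of_nat m - 1 - 2 * s) *
      binrem L (- s) (of_real (- ((real K - 1/2) / ?x n)\<^sup>2)))" if "Re s > real K - real L" for s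
    using *(2)[of s] that by simp
qed

text \<open>The base is \<open>x^2 * (1 - (a / x)^2)\<close>, and \<open>x ^ (2 * m - 1)\<close>
  times \<open>x powr (-2 * s - 2 * l)\<close> explains the argument of \<open>half_zeta\<close>.
  For \<open>Re s > K\<close> all these arguments have real part above 1. \<open>L\<close> stays
  free so that the remainder can be continued arbitrarily far.\<close>

lemma Z_series_expansion:
  fixes s :: complex
  assumes K: "K \<ge> 1" and s: "Re s > real K"
  shows "(\<lambda>n. P (2 * K) (Suc n) / of_nat (Suc n * (Suc n + 2 * K - 1)) powr s) sums
    ((\<Sum>m=1..K. B (2 * K) (2 * m - 1) *
       ((\<Sum>l<L. ((-s) gchoose l) * (- (of_real (real K - 1/2))\<^sup>2) ^ l *
           half_zeta K (2 * (s + of_nat l - of_nat m) + 1)) + Z_rem K m L s)) / fact (2 * K - 1))"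
proof -
  define x where "x = (\<lambda>n::nat. real n + real K + 1/2)"
  define a where "a = real K - 1/2"
  have x0: "x n > 0" for n using K by (simp add: x_def)
  have ax: "0 < a" "a < x n" for n using K by (auto simp: x_def a_def)
  let ?R = "\<lambda>m n. of_real (x n) powr (2 * of_nat m - 1 - 2 * s) * binrem L (- s) (of_real (- (a / x n)\<^sup>2))"
  have expand: "of_real (x n) ^ (2 * m - 1) / of_nat (Suc n * (Suc n + 2 * K - 1)) powr s =
     (\<Sum>l<L. ((-s) gchoose l) * (- (of_real a)\<^sup>2) ^ l * of_real (x n) powr (- (2 * (s + of_nat l - of_nat m) + 1))) + ?R m n"
    if m: "m \<ge> 1" for m n
  proof -
    let ?u = "- (a / x n)\<^sup>2"
    have "(a / x n)\<^sup>2 < 1" using ax x0[of n] power_strict_mono[of "a / x n" 1 2] by simp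
    hence u: "?u > -1" by simp
    have "(x n)\<^sup>2 * (1 + ?u) = (x n)\<^sup>2 - a\<^sup>2"
      using x0[of n] by (simp add: power_divide right_diff_distrib)
    also have "\<dots> = real (Suc n * (Suc n + 2 * K - 1))"
      using K by (simp add: x_def a_def of_nat_diff power2_eq_square algebra_simps)
    finally have "real (Suc n * (Suc n + 2 * K - 1)) = (x n)\<^sup>2 * (1 + ?u)" ..
    hence "1 / of_nat (Suc n * (Suc n + 2 * K - 1)) powr s = complex_of_real ((x n)\<^sup>2 * (1 + ?u)) powr (- s)"
      by (metis of_real_of_nat_eq powr_minus_divide)
    also have "\<dots> = (\<Sum>l<L. ((-s) gchoose l) * (of_real ((x n)\<^sup>2) powr (-s) * of_real ?u ^ l)) + of_real ((x n)\<^sup>2) powr (-s) * binrem L (-s) (of_real ?u)"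
      using x0[of n] u by (intro powr_mult_binomial_expansion) auto
    finally have e: "of_real (x n) ^ (2 * m - 1) / of_nat (Suc n * (Suc n + 2 * K - 1)) powr s =
      (\<Sum>l<L. ((-s) gchoose l) * (of_real (x n) ^ (2 * m - 1) * of_real ((x n)\<^sup>2) powr (-s) * of_real ?u ^ l)) +
      of_real (x n) ^ (2 * m - 1) * of_real ((x n)\<^sup>2) powr (-s) * binrem L (-s) (of_real ?u)"
      by (simp only: divide_inverse mult_1_left ring_distribs sum_distrib_left mult_ac)
    have p: "of_real (x n) ^ (2 * m - 1) * of_real ((x n)\<^sup>2) powr (-s) = complex_of_real (x n) powr (2 * of_nat m - 1 - 2 * s)"
    proof -
      have "complex_of_real (x n) ^ (2 * m - 1) = of_real (x n) powr (of_nat (2 * m - 1))"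
        using x0[of n] by (subst powr_nat') auto
      moreover have "complex_of_real ((x n)\<^sup>2) powr (-s) = of_real (x n) powr (-2 * s)"
        using x0[of n] by (simp add: powr_def Ln_of_real ln_realpow mult_ac flip: of_real_power)
      ultimately show ?thesis using m by (simp add: powr_add [symmetric] of_nat_diff)
    qed
    have q: "complex_of_real (x n) powr (2 * of_nat m - 1 - 2 * s) * of_real ?u ^ l =
      (- (of_real a)\<^sup>2) ^ l * of_real (x n) powr (- (2 * (s + of_nat l - of_nat m) + 1))" for l
    proof -
      have "complex_of_real ?u = (- (of_real a)\<^sup>2) * of_real (x n) powr (-2)"
        using x0[of n] by (simp add: powr_minus power_mult_distrib power_inverse divide_inverse)
      hence "complex_of_real ?u ^ l = (- (of_real a)\<^sup>2) ^ l * (of_real (x n) powr (-2)) ^ l"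
        by (simp only: power_mult_distrib)
      also have "(complex_of_real (x n) powr (-2)) ^ l = of_real (x n) powr (-2 * of_nat l)"
        using x0[of n] by (simp add: powr_def exp_of_nat_mult [symmetric] mult_ac)
      finally show ?thesis by (simp add: powr_add [symmetric] algebra_simps)
    qed
    show ?thesis unfolding e p q by (simp only: mult.assoc)
  qed
  have hz: "(\<lambda>n. complex_of_real (x n) powr (- w)) sums half_zeta K w" if "Re w > 1" for w
    unfolding half_zeta_def x_def by (rule odd_half_sums[OF that])
  have "(\<lambda>n. (\<Sum>m=1..K. B (2 * K) (2 * m - 1) * (of_real (x n) ^ (2 * m - 1) / of_nat (Suc n * (Suc n + 2 * K - 1)) powr s)) / fact (2 * K - 1)) sums
     ((\<Sum>m=1..K. B (2 * K) (2 * m - 1) *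
       ((\<Sum>l<L. ((-s) gchoose l) * (- (of_real a)\<^sup>2) ^ l *
           half_zeta K (2 * (s + of_nat l - of_nat m) + 1)) + Z_rem K m L s)) / fact (2 * K - 1))"
  proof (intro sums_divide sums_sum sums_mult)
    fix m assume m: "m \<in> {1..K}"
    have "?R m sums Z_rem K m L s"
      using Z_rem(2)[OF K, of m L s] m s unfolding x_def a_def Z_rem_def by (simp add: summable_sums)
    moreover have "(\<lambda>n. \<Sum>l<L. ((-s) gchoose l) * (- (of_real a)\<^sup>2) ^ l * of_real (x n) powr (- (2 * (s + of_nat l - of_nat m) + 1))) sums
       (\<Sum>l<L. ((-s) gchoose l) * (- (of_real a)\<^sup>2) ^ l * half_zeta K (2 * (s + of_nat l - of_nat m) + 1))"
      using m s by (intro sums_sum sums_mult hz) auto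
    ultimately show "(\<lambda>n. of_real (x n) ^ (2 * m - 1) / of_nat (Suc n * (Suc n + 2 * K - 1)) powr s) sums
      ((\<Sum>l<L. ((-s) gchoose l) * (- (of_real a)\<^sup>2) ^ l * half_zeta K (2 * (s + of_nat l - of_nat m) + 1)) + Z_rem K m L s)"
      using m by (simp only: expand atLeastAtMost_iff) (intro sums_add)
  qed
  moreover have "(\<Sum>m=1..K. B (2 * K) (2 * m - 1) * (of_real (x n) ^ (2 * m - 1) / of_nat (Suc n * (Suc n + 2 * K - 1)) powr s)) / fact (2 * K - 1) =
     P (2 * K) (Suc n) / of_nat (Suc n * (Suc n + 2 * K - 1)) powr s" for n
  proof -
    have "real (Suc n) + real K - 1/2 = x n" by (simp add: x_def)
    thus ?thesis unfolding P_eq_sum_B[OF K] by (simp only: sum_divide_distrib times_divide_eq_right divide_divide_eq_left mult_ac)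
  qed
  ultimately show ?thesis unfolding a_def by simp
qed

section \<open>Values at nonpositive integers\<close>

text \<open>The argument is a negative odd integer, so complex powers become ordinary ones. The
  exponent is split so that \<open>y ^ (2 * m - 1)\<close> and \<open>(y^2) ^ (n - l)\<close> can
  later be separated for the binomial theorem.\<close>

lemma half_zeta_neg_odd:
  assumes "m \<ge> 1" "l \<le> n"
  shows "half_zeta K (2 * (- of_nat n + of_nat l - of_nat m) + 1) =
    (2 powi (1 + 2 * int l - 2 * int m - 2 * int n) - 1) * zeta (of_int (1 + 2 * int l - 2 * int m - 2 * int n)) -
    (\<Sum>i<K. complex_of_real (real i + 1/2) ^ (2 * (n - l) + (2 * m - 1)))"
proof -
  define e where "e = 1 + 2 * int l - 2 * int m - 2 * int n"
  have e: "2 * (- of_nat n + of_nat l - of_nat m) + 1 = complex_of_int e" by (simp add: e_def)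
  have e': "- complex_of_int e = of_nat (2 * (n - l) + (2 * m - 1))"
    using assms by (simp add: e_def of_nat_diff algebra_simps)
  have "complex_of_real (real i + 1/2) powr (- of_int e) = complex_of_real (real i + 1/2) ^ (2 * (n - l) + (2 * m - 1))" for i
  proof -
    have "real i + 1/2 > 0" by simp
    hence "complex_of_real (real i + 1/2) \<noteq> 0" by (metis of_real_eq_0_iff less_irrefl)
    thus ?thesis unfolding e' by (rule powr_complexpow)
  qed
  moreover have "2 powr complex_of_int e = 2 powi e" by (simp add: complex_powr_of_int)
  ultimately show ?thesis unfolding e half_zeta_def by (simp add: e_def)
qed

text \<open>Multiplication by \<open>pole_poly K\<close> makes the continuation entire, and its
  value at \<open>-n\<close> is read off from a single expansion. Terms with
  \<open>l \<le> n\<close> give zeta values, the term \<open>l = n + m\<close> gives the Gamma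
  quotient (here in factorials), and the half-integers up to \<open>K - 1/2\<close> give the last
  summand.\<close>

lemma Z_at_nonpos_integer:
  assumes K: "K \<ge> 1"
  defines "a \<equiv> complex_of_real (real K - 1/2)"
  shows "Z (2 * K) (- of_nat n) =
    1 / fact (2 * K - 1) * (\<Sum>m=1..K. B (2 * K) (2 * m - 1) *
      ((\<Sum>l\<le>n. (-1) ^ l * of_nat (n choose l) * a ^ (2 * l) *
           (2 powi (1 + 2 * int l - 2 * int m - 2 * int n) - 1) * zeta (of_int (1 + 2 * int l - 2 * int m - 2 * int n)))
       + (-1) ^ n * fact n / 2 * (fact (m - 1) / fact (n + m)) * a ^ (2 * (n + m))))
    - (if n = 0 then 1 else 0)"
proof -
  define b where "b = (\<lambda>m. B (2 * K) (2 * m - 1))"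
  define hz where "hz = (\<lambda>m l s. half_zeta K (2 * (s + of_nat l - of_nat m) + 1))"
  obtain E where E: "E holomorphic_on UNIV" "E 1 = 1" "\<And>w. E w = (w - 1) * half_zeta K w \<or> w = 1"
    using half_zeta_entire[of K] by blast
  \<comment> \<open>The entire form of binomial coefficient times \<open>pole_poly\<close> times
    \<open>half_zeta\<close>. The division by 2 compensates
    \<open>w - 1 = 2 * (s + l - m)\<close>.\<close>
  define T where "T = (\<lambda>m l s. bin_quot K m l s * E (2 * (s + of_nat l - of_nat m) + 1) / 2)"
  have T_hz: "T m l s = ((-s) gchoose l) * pole_poly K s * hz m l s"
    if "1 \<le> m" "m \<le> K" "s + of_nat l - of_nat m \<noteq> 0" for m l s
  proof -
    have "2 * z + 1 \<noteq> 1" if "z \<noteq> 0" for z :: complex using that by simp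
    from this[OF that(3)] have "2 * (s + of_nat l - of_nat m) + 1 \<noteq> 1" .
    hence "E (2 * (s + of_nat l - of_nat m) + 1) = 2 * (s + of_nat l - of_nat m) * hz m l s"
      using E(3)[of "2 * (s + of_nat l - of_nat m) + 1"] by (simp add: hz_def)
    hence "T m l s = (bin_quot K m l s * (s + of_nat l - of_nat m)) * hz m l s" by (simp add: T_def)
    thus ?thesis by (simp only: bin_quot[OF that(1,2)])
  qed
  define H where "H = (\<lambda>L s. (\<Sum>m=1..K. b m * ((\<Sum>l<L. (- a\<^sup>2) ^ l * T m l s) + pole_poly K s * Z_rem K m L s)) / fact (2 * K - 1))"
  define Zs where "Zs = (\<lambda>s. \<Sum>n. P (2 * K) (Suc n) / of_nat (Suc n * (Suc n + 2 * K - 1)) powr s)"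
  have H_holo: "H L holomorphic_on {s. Re s > real K - real L}" for L
  proof -
    have "(E \<circ> (\<lambda>s. 2 * (s + of_nat l - of_nat m) + 1)) holomorphic_on {s. Re s > real K - real L}" for l m
      by (rule holomorphic_on_compose_gen[OF _ E(1)]) (auto intro!: holomorphic_intros)
    hence "T m l holomorphic_on {s. Re s > real K - real L}" for l m
      unfolding T_def o_def by (intro holomorphic_intros bin_quot_holomorphic) auto
    thus ?thesis unfolding H_def pole_poly_def
      by (intro holomorphic_intros Z_rem(1)[OF K]) auto
  qed
  have H_eq: "H L s = pole_poly K s * Zs s" if s: "Re s > real K" for L s
  proof -
    have "T m l s = ((-s) gchoose l) * pole_poly K s * hz m l s" if "m \<in> {1..K}" for m l
    proof (rule T_hz)
      have "Re (s + of_nat l - of_nat m) > 0" using s that by simp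
      thus "s + of_nat l - of_nat m \<noteq> 0" by force
    qed (use that in auto)
    hence "H L s = (\<Sum>m=1..K. b m * ((\<Sum>l<L. (- a\<^sup>2) ^ l * (((-s) gchoose l) * pole_poly K s * hz m l s)) + pole_poly K s * Z_rem K m L s)) / fact (2 * K - 1)"
      unfolding H_def by simp
    also have "\<dots> = pole_poly K s * Zs s"
      using Z_series_expansion[OF K s, of L] unfolding Zs_def a_def b_def hz_def
      by (simp add: sums_iff sum_distrib_left ring_distribs mult_ac)
    finally show ?thesis .
  qed
  have "\<exists>g. g holomorphic_on {s. Re s > - real N} \<and> (\<forall>s. Re s > real K \<longrightarrow> g s = pole_poly K s * Zs s)" for N
    using H_holo[of "N + K"] H_eq by auto
  then obtain h where h: "h holomorphic_on UNIV" "\<And>s. Re s > real K \<Longrightarrow> h s = pole_poly K s * Zs s"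
    using entire_from_half_planes[of "real K" "\<lambda>s. pole_poly K s * Zs s"] by blast
  have Qh: "pole_poly K holomorphic_on UNIV" unfolding pole_poly_def by (intro holomorphic_intros)
  have Z_eq: "Z (2 * K) = remove_sings (\<lambda>s. h s / pole_poly K s)"
    unfolding Z_def
  proof (rule meromorphic_continuation_eqI)
    show "remove_sings (\<lambda>s. h s / pole_poly K s) nicely_meromorphic_on UNIV"
      by (rule remove_sings_quotient(1)[OF h(1) Qh])
    fix s :: complex assume "real (2 * K) / 2 < Re s"
    hence s: "Re s > real K" by simp
    have "pole_poly K s \<noteq> 0" using s by (auto simp: pole_poly_def)
    thus "remove_sings (\<lambda>s. h s / pole_poly K s) s = (\<Sum>n. P (2 * K) (Suc n) / of_nat (Suc n * (Suc n + 2 * K - 1)) powr s)"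
      using h(2)[OF s] remove_sings_quotient(2)[OF h(1) Qh] by (simp add: Zs_def)
  qed
  \<comment> \<open>Large enough for three purposes: \<open>-n\<close> lies to the right of
    \<open>K - L\<close>, the remainder vanishes since \<open>n < L\<close>, and every index
    \<open>l = n + m\<close> with \<open>m \<le> K\<close> occurs.\<close>
  define L where "L = n + K + 1"
  let ?s = "- of_nat n :: complex"
  have Q0: "pole_poly K ?s \<noteq> 0" by (rule pole_poly_neg_nonzero)
  have "h ?s = H L ?s"
  proof (rule half_plane_eqI[where f = h and g = "H L" and c = "real K" and d = "real K - real L"])
    show "h holomorphic_on {s. Re s > real K - real L}" using h(1) by (rule holomorphic_on_subset) auto
    show "real K - real L < Re ?s" by (simp add: L_def)
  qed (use h(2) H_eq H_holo in auto)
  hence "Z (2 * K) ?s = H L ?s / pole_poly K ?s"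
    unfolding Z_eq using Q0 by (simp add: remove_sings_quotient(2)[OF h(1) Qh])
  also have "\<dots> = (\<Sum>m=1..K. b m * (\<Sum>l<L. (- a\<^sup>2) ^ l * (T m l ?s / pole_poly K ?s))) / fact (2 * K - 1)"
  proof -
    have "binrem L (of_nat n) (of_real (- ((real K - 1/2) / (real j + real K + 1/2))\<^sup>2)) = 0" for j
    proof (rule binrem_of_nat)
      have "((real K - 1/2) / (real j + real K + 1/2))\<^sup>2 < 1"
        using K power_strict_mono[of "(real K - 1/2) / (real j + real K + 1/2)" 1 2] by simp
      thus "norm (complex_of_real (- ((real K - 1/2) / (real j + real K + 1/2))\<^sup>2)) < 1"
        by (subst norm_of_real) simp
    qed (simp add: L_def)
    hence "Z_rem K m L ?s = 0" for m unfolding Z_rem_def minus_minus by (simp only: mult_zero_right suminf_zero)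
    hence "H L ?s = (\<Sum>m=1..K. b m * (\<Sum>l<L. (- a\<^sup>2) ^ l * T m l ?s)) / fact (2 * K - 1)"
      unfolding H_def by simp
    moreover have "(\<Sum>l<L. (- a\<^sup>2) ^ l * (T m l ?s / pole_poly K ?s)) = (\<Sum>l<L. (- a\<^sup>2) ^ l * T m l ?s) / pole_poly K ?s" for m
      by (simp only: times_divide_eq_right sum_divide_distrib)
    moreover have "(\<Sum>m=1..K. b m * (S m / q)) / F = (\<Sum>m=1..K. b m * S m) / F / q" for S and q F :: complex
      by (simp only: times_divide_eq_right sum_divide_distrib [symmetric] divide_divide_eq_left mult.commute[of F q])
    ultimately show ?thesis by (simp only:)
  qed
  also have "(\<Sum>m=1..K. b m * (\<Sum>l<L. (- a\<^sup>2) ^ l * (T m l ?s / pole_poly K ?s))) =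
     (\<Sum>m=1..K. b m * ((\<Sum>l\<le>n. (- a\<^sup>2) ^ l * of_nat (n choose l) * hz m l ?s) +
        (-1) ^ n * fact n / 2 * (fact (m - 1) / fact (n + m)) * a ^ (2 * (n + m))))"
  proof (intro sum.cong refl arg_cong2[where f = "(*)"])
    fix m assume m: "m \<in> {1..K}"
    have split: "{..<L} = {..n} \<union> {n<..<L}" by (auto simp: L_def)
    have "(\<Sum>l<L. (- a\<^sup>2) ^ l * (T m l ?s / pole_poly K ?s)) =
       (\<Sum>l\<le>n. (- a\<^sup>2) ^ l * (T m l ?s / pole_poly K ?s)) + (\<Sum>l\<in>{n<..<L}. (- a\<^sup>2) ^ l * (T m l ?s / pole_poly K ?s))"
      unfolding split by (rule sum.union_disjoint) auto
    also have "(\<Sum>l\<le>n. (- a\<^sup>2) ^ l * (T m l ?s / pole_poly K ?s)) = (\<Sum>l\<le>n. (- a\<^sup>2) ^ l * of_nat (n choose l) * hz m l ?s)"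
    proof (intro sum.cong refl)
      fix l assume l: "l \<in> {..n}"
      have "?s + of_nat l - of_nat m = - complex_of_nat (n - l + m)" using l by (simp add: of_nat_diff)
      moreover have "n - l + m \<noteq> 0" using m by auto
      ultimately have "?s + of_nat l - of_nat m \<noteq> 0" by (metis neg_equal_0_iff_equal of_nat_eq_0_iff)
      thus "(- a\<^sup>2) ^ l * (T m l ?s / pole_poly K ?s) = (- a\<^sup>2) ^ l * of_nat (n choose l) * hz m l ?s"
        using m Q0 by (subst T_hz) (auto simp: binomial_gbinomial)
    qed
    \<comment> \<open>At \<open>s = -n\<close> the binomial coefficient vanishes for \<open>l > n\<close>, except that for \<open>l = n + m\<close> this zero is
      cancelled by the pole of the zeta function: this gives the Gamma quotient.\<close>
    also have "(\<Sum>l\<in>{n<..<L}. (- a\<^sup>2) ^ l * (T m l ?s / pole_poly K ?s)) = (\<Sum>l\<in>{n + m}. (- a\<^sup>2) ^ l * (T m l ?s / pole_poly K ?s))"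
    proof (rule sum.mono_neutral_right)
      show "\<forall>l\<in>{n<..<L} - {n + m}. (- a\<^sup>2) ^ l * (T m l ?s / pole_poly K ?s) = 0"
      proof
        fix l assume l: "l \<in> {n<..<L} - {n + m}"
        have "?s + of_nat l - of_nat m \<noteq> 0"
        proof
          assume "?s + of_nat l - of_nat m = 0"
          hence "complex_of_nat l = of_nat (n + m)" by (simp add: algebra_simps)
          thus False using l by (simp only: of_nat_eq_iff) auto
        qed
        moreover have "(of_nat n gchoose l :: complex) = 0" using l by (simp flip: binomial_gbinomial)
        ultimately show "(- a\<^sup>2) ^ l * (T m l ?s / pole_poly K ?s) = 0" using m by (subst T_hz) auto
      qed
    qed (use m in \<open>auto simp: L_def\<close>)
    also have "\<dots> = (-1) ^ n * fact n / 2 * (fact (m - 1) / fact (n + m)) * a ^ (2 * (n + m))"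
    proof -
      \<comment> \<open>Here the argument of \<open>E\<close> is 1, so the residue
        \<open>E 1 = 1\<close> enters in place of a zeta value.\<close>
      have t: "T m (n + m) ?s = (-1) ^ m * (fact n * fact (m - 1) / fact (n + m)) * pole_poly K ?s / 2"
        using m bin_quot_at_pole[of m K n] by (simp add: T_def E(2))
      have p: "(- a\<^sup>2) ^ (n + m) = (-1) ^ n * (-1) ^ m * a ^ (2 * (n + m))"
        by (simp add: power_minus[of "a\<^sup>2"] power_mult power_add)
      have cancel: "(v * u * x) * ((u * (f * g / h) * q / 2) / q) = v * f / 2 * (g / h) * x"
        if "u * u = 1" "q \<noteq> 0" for v u x f g h q :: complex
      proof -
        have "(v * u * x) * ((u * (f * g / h) * q / 2) / q) = (u * u) * (v * f / 2 * (g / h) * x)"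
          using that(2) by (simp add: mult_ac)
        thus ?thesis using that(1) by simp
      qed
      have "(-1) ^ m * (-1) ^ m = (1 :: complex)" by (simp flip: power_mult_distrib)
      from cancel[OF this Q0] have "(- a\<^sup>2) ^ (n + m) * (T m (n + m) ?s / pole_poly K ?s) =
          (-1) ^ n * fact n / 2 * (fact (m - 1) / fact (n + m)) * a ^ (2 * (n + m))"
        unfolding t p .
      thus ?thesis by simp
    qed
    finally show "(\<Sum>l<L. (- a\<^sup>2) ^ l * (T m l ?s / pole_poly K ?s)) =
      (\<Sum>l\<le>n. (- a\<^sup>2) ^ l * of_nat (n choose l) * hz m l ?s) +
      (-1) ^ n * fact n / 2 * (fact (m - 1) / fact (n + m)) * a ^ (2 * (n + m))" .
  qed
  also have "\<dots> = (\<Sum>m=1..K. b m * ((\<Sum>l\<le>n. (-1) ^ l * of_nat (n choose l) * a ^ (2 * l) *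
           (2 powi (1 + 2 * int l - 2 * int m - 2 * int n) - 1) * zeta (of_int (1 + 2 * int l - 2 * int m - 2 * int n)))
       + (-1) ^ n * fact n / 2 * (fact (m - 1) / fact (n + m)) * a ^ (2 * (n + m))))
     - (\<Sum>m=1..K. b m * (\<Sum>l\<le>n. (- a\<^sup>2) ^ l * of_nat (n choose l) * (\<Sum>i<K. complex_of_real (real i + 1/2) ^ (2 * (n - l) + (2 * m - 1)))))"
    unfolding sum_subtractf [symmetric]
  proof (intro sum.cong refl)
    fix m assume m: "m \<in> {1..K}"
    have "(\<Sum>l\<le>n. (- a\<^sup>2) ^ l * of_nat (n choose l) * hz m l ?s) =
      (\<Sum>l\<le>n. (-1) ^ l * of_nat (n choose l) * a ^ (2 * l) *
           (2 powi (1 + 2 * int l - 2 * int m - 2 * int n) - 1) * zeta (of_int (1 + 2 * int l - 2 * int m - 2 * int n))) -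
      (\<Sum>l\<le>n. (- a\<^sup>2) ^ l * of_nat (n choose l) * (\<Sum>i<K. complex_of_real (real i + 1/2) ^ (2 * (n - l) + (2 * m - 1))))"
      unfolding sum_subtractf [symmetric]
    proof (intro sum.cong refl)
      fix l assume l: "l \<in> {..n}"
      have "(- a\<^sup>2) ^ l = (-1) ^ l * a ^ (2 * l)" by (simp add: power_minus[of "a\<^sup>2"] power_mult)
      moreover have "p * c * (u * v - w) = q * c * r * u * v - p * c * w" if "p = q * r" for p q r c u v w :: complex
        using that by (simp add: algebra_simps)
      ultimately show "(- a\<^sup>2) ^ l * of_nat (n choose l) * hz m l ?s =
        (-1) ^ l * of_nat (n choose l) * a ^ (2 * l) *
           (2 powi (1 + 2 * int l - 2 * int m - 2 * int n) - 1) * zeta (of_int (1 + 2 * int l - 2 * int m - 2 * int n)) -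
        (- a\<^sup>2) ^ l * of_nat (n choose l) * (\<Sum>i<K. complex_of_real (real i + 1/2) ^ (2 * (n - l) + (2 * m - 1)))"
        unfolding hz_def using m l by (subst half_zeta_neg_odd) auto
    qed
    moreover have "b * ((p - q) + r) = b * (p + r) - b * q" for b p q r :: complex
      by (simp add: algebra_simps)
    ultimately show "b m * ((\<Sum>l\<le>n. (- a\<^sup>2) ^ l * of_nat (n choose l) * hz m l ?s) +
        (-1) ^ n * fact n / 2 * (fact (m - 1) / fact (n + m)) * a ^ (2 * (n + m))) =
      b m * ((\<Sum>l\<le>n. (-1) ^ l * of_nat (n choose l) * a ^ (2 * l) *
           (2 powi (1 + 2 * int l - 2 * int m - 2 * int n) - 1) * zeta (of_int (1 + 2 * int l - 2 * int m - 2 * int n)))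
       + (-1) ^ n * fact n / 2 * (fact (m - 1) / fact (n + m)) * a ^ (2 * (n + m))) -
      b m * (\<Sum>l\<le>n. (- a\<^sup>2) ^ l * of_nat (n choose l) * (\<Sum>i<K. complex_of_real (real i + 1/2) ^ (2 * (n - l) + (2 * m - 1))))"
      by presburger
  qed
  \<comment> \<open>For each half-integer \<open>y\<close> the binomial theorem turns the sum over
    \<open>l\<close> into \<open>(y^2 - a^2) ^ n\<close>, and \<open>sum_B_at_half_integers\<close>
    applies.\<close>
  also have "(\<Sum>m=1..K. b m * (\<Sum>l\<le>n. (- a\<^sup>2) ^ l * of_nat (n choose l) * (\<Sum>i<K. complex_of_real (real i + 1/2) ^ (2 * (n - l) + (2 * m - 1))))) =
      (if n = 0 then fact (2 * K - 1) else 0)"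
  proof -
    let ?y = "\<lambda>i. complex_of_real (real i + 1/2)"
    have "(\<Sum>m=1..K. b m * (\<Sum>l\<le>n. (- a\<^sup>2) ^ l * of_nat (n choose l) * (\<Sum>i<K. ?y i ^ (2 * (n - l) + (2 * m - 1))))) =
      (\<Sum>m=1..K. \<Sum>i<K. \<Sum>l\<le>n. b m * ((- a\<^sup>2) ^ l * of_nat (n choose l) * ?y i ^ (2 * (n - l) + (2 * m - 1))))"
      unfolding sum_distrib_left by (rule sum.cong[OF refl], rule sum.swap)
    also have "\<dots> = (\<Sum>i<K. \<Sum>m=1..K. \<Sum>l\<le>n. b m * ((- a\<^sup>2) ^ l * of_nat (n choose l) * ?y i ^ (2 * (n - l) + (2 * m - 1))))"
      by (rule sum.swap)
    also have "\<dots> = (\<Sum>i<K. (\<Sum>m=1..K. b m * ?y i ^ (2 * m - 1)) * of_real ((real i + 1/2)\<^sup>2 - (real K - 1/2)\<^sup>2) ^ n)"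
    proof (intro sum.cong refl)
      fix i
      have "complex_of_real ((real i + 1/2)\<^sup>2 - (real K - 1/2)\<^sup>2) = - a\<^sup>2 + (?y i)\<^sup>2" by (simp add: a_def)
      hence pow: "complex_of_real ((real i + 1/2)\<^sup>2 - (real K - 1/2)\<^sup>2) ^ n = (\<Sum>l\<le>n. of_nat (n choose l) * (- a\<^sup>2) ^ l * ((?y i)\<^sup>2) ^ (n - l))"
        by (simp only: binomial_ring)
      show "(\<Sum>m=1..K. \<Sum>l\<le>n. b m * ((- a\<^sup>2) ^ l * of_nat (n choose l) * ?y i ^ (2 * (n - l) + (2 * m - 1)))) =
         (\<Sum>m=1..K. b m * ?y i ^ (2 * m - 1)) * of_real ((real i + 1/2)\<^sup>2 - (real K - 1/2)\<^sup>2) ^ n"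
        unfolding pow sum_product
        by (intro sum.cong refl) (simp only: power_add power_mult [symmetric] mult_ac)
    qed
    also have "\<dots> = (if n = 0 then fact (2 * K - 1) else 0)"
      unfolding b_def by (rule sum_B_at_half_integers[OF K])
    finally show ?thesis .
  qed
  finally show ?thesis by (simp add: b_def diff_divide_distrib)
qed

text \<open>For even \<open>k\<close> the Gamma arguments are positive integers, so the quotient is
  one of factorials. Substituting \<open>m = K - h\<close> then gives both formulas.\<close>

theorem theorem10:
  fixes k :: nat
  assumes "k \<ge> 2" and "even k"
  shows
    "Z k 0 =
       1 / fact (k - 1) * (\<Sum>h = 0..(k - 2) div 2. B k (k - 2 * h - 1) *
         ((2 powi (2 * int h + 1 - int k) - 1) * zeta (of_int (2 * int h + 1 - int k))
          + 1 / of_nat (k - 2 * h) * (of_nat (k - 1) / 2) ^ (k - 2 * h))) - 1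
     \<and>
     (\<forall>n::nat. n > 0 \<longrightarrow>
       Z k (- of_nat n) =
       1 / fact (k - 1) * (\<Sum>h = 0..(k - 2) div 2. B k (k - 2 * h - 1) *
         ((\<Sum>l = 0..n. (-1) ^ l * of_nat (n choose l) * (of_nat (k - 1) / 2) ^ (2 * l)
             * (2 powi (2 * int h + 1 + 2 * int l - 2 * int n - int k) - 1)
             * zeta (of_int (2 * int h + 1 + 2 * int l - 2 * int n - int k)))
          + (-1) ^ n * fact n / 2
             * (Gamma (of_nat (k - 2 * h) / 2) / Gamma (of_nat (k - 2 * h) / 2 + of_nat n + 1))
             * (of_nat (k - 1) / 2) ^ (k - 2 * h + 2 * n))))"
proof -
  obtain K where k: "k = 2 * K" using assms by (auto elim: evenE)
  have K: "K \<ge> 1" using k assms by simp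
  let ?a = "complex_of_nat (k - 1) / 2"
  have a: "complex_of_real (real K - 1/2) = ?a" using K by (simp add: k of_nat_diff field_simps)
  have reindex: "(\<Sum>m=1..K. f m) = (\<Sum>h=0..(k - 2) div 2. f (K - h))" for f :: "nat \<Rightarrow> complex"
    by (rule sum.reindex_bij_witness[of _ "\<lambda>h. K - h" "\<lambda>m. K - m"]) (use K k in auto)
  have main: "Z k (- of_nat n) = 1 / fact (k - 1) * (\<Sum>h=0..(k - 2) div 2. B k (k - 2 * h - 1) *
      ((\<Sum>l = 0..n. (-1) ^ l * of_nat (n choose l) * ?a ^ (2 * l) *
           (2 powi (2 * int h + 1 + 2 * int l - 2 * int n - int k) - 1) * zeta (of_int (2 * int h + 1 + 2 * int l - 2 * int n - int k)))
       + (-1) ^ n * fact n / 2 * (fact (K - h - 1) / fact (n + (K - h))) * ?a ^ (k - 2 * h + 2 * n)))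
    - (if n = 0 then 1 else 0)" for n
    unfolding k Z_at_nonpos_integer[OF K] a[unfolded k] reindex[unfolded k]
  proof (intro arg_cong2[where f = "(-)"] arg_cong2[where f = "(*)"] sum.cong refl)
    fix h assume "h \<in> {0..(2 * K - 2) div 2}"
    hence h: "h \<le> K - 1" "h < K" using K by auto
    show "B (2 * K) (2 * (K - h) - 1) = B (2 * K) (2 * K - 2 * h - 1)"
      by (simp add: diff_mult_distrib2)
    have "1 + 2 * int l - 2 * int (K - h) - 2 * int n = 2 * int h + 1 + 2 * int l - 2 * int n - int (2 * K)" for l
      using h by (simp add: of_nat_diff)
    moreover have "2 * (n + (K - h)) = 2 * K - 2 * h + 2 * n" using h by simp
    ultimately show "(\<Sum>l\<le>n. (-1) ^ l * of_nat (n choose l) * (of_nat (2 * K - 1) / 2) ^ (2 * l) *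
           (2 powi (1 + 2 * int l - 2 * int (K - h) - 2 * int n) - 1) * zeta (of_int (1 + 2 * int l - 2 * int (K - h) - 2 * int n)))
       + (-1) ^ n * fact n / 2 * (fact (K - h - 1) / fact (n + (K - h))) * (of_nat (2 * K - 1) / 2) ^ (2 * (n + (K - h))) =
      (\<Sum>l = 0..n. (-1) ^ l * of_nat (n choose l) * (of_nat (2 * K - 1) / 2) ^ (2 * l) *
           (2 powi (2 * int h + 1 + 2 * int l - 2 * int n - int (2 * K)) - 1) * zeta (of_int (2 * int h + 1 + 2 * int l - 2 * int n - int (2 * K))))
       + (-1) ^ n * fact n / 2 * (fact (K - h - 1) / fact (n + (K - h))) * (of_nat (2 * K - 1) / 2) ^ (2 * K - 2 * h + 2 * n)"
      by (simp only: atLeast0AtMost)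
  qed
  have K_minus: "complex_of_nat (k - 2 * h) / 2 = of_nat (K - h)" "K - h \<ge> 1" if "h \<in> {0..(k - 2) div 2}" for h
  proof -
    have "k - 2 * h = 2 * (K - h)" by (simp add: k)
    thus "complex_of_nat (k - 2 * h) / 2 = of_nat (K - h)" by simp
    show "K - h \<ge> 1" using that K by (auto simp: k)
  qed
  have Gamma_eq: "Gamma (complex_of_nat (k - 2 * h) / 2) / Gamma (of_nat (k - 2 * h) / 2 + of_nat n + 1) =
      fact (K - h - 1) / fact (n + (K - h))" if "h \<in> {0..(k - 2) div 2}" for h n
  proof -
    have "Gamma (of_nat (K - h) :: complex) = fact (K - h - 1)"
      using K_minus(2)[OF that] Gamma_fact[of "K - h - 1", where 'a = complex] by simp
    moreover have "Gamma (of_nat (K - h) + of_nat n + 1 :: complex) = fact (n + (K - h))"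
      using Gamma_fact[of "n + (K - h)", where 'a = complex] by (simp add: add_ac)
    ultimately show ?thesis unfolding K_minus(1)[OF that] by simp
  qed
  \<comment> \<open>For \<open>n = 0\<close> the factorials collapse to
    \<open>1 / (2 * (K - h))\<close>, so the first formula is the general one at
    \<open>n = 0\<close> with the extra \<open>-1\<close>.\<close>
  have half: "fact 0 / 2 * (fact (K - h - 1) / fact (0 + (K - h))) = 1 / complex_of_nat (k - 2 * h)" if "h \<in> {0..(k - 2) div 2}" for h
  proof -
    have "complex_of_nat (k - 2 * h) = 2 * of_nat (K - h)" using K_minus(1)[OF that] by simp
    moreover have "fact (K - h) = (of_nat (K - h) * fact (K - h - 1) :: complex)"
      using K_minus(2)[OF that] by (intro fact_reduce) auto
    ultimately show ?thesis by simp
  qed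
  show ?thesis
  proof (intro conjI allI impI)
    show "Z k 0 =
       1 / fact (k - 1) * (\<Sum>h = 0..(k - 2) div 2. B k (k - 2 * h - 1) *
         ((2 powi (2 * int h + 1 - int k) - 1) * zeta (of_int (2 * int h + 1 - int k))
          + 1 / of_nat (k - 2 * h) * (of_nat (k - 1) / 2) ^ (k - 2 * h))) - 1"
    proof -
      have "Z k 0 = 1 / fact (k - 1) * (\<Sum>h = 0..(k - 2) div 2. B k (k - 2 * h - 1) *
         ((2 powi (2 * int h + 1 - int k) - 1) * zeta (of_int (2 * int h + 1 - int k))
          + fact 0 / 2 * (fact (K - h - 1) / fact (0 + (K - h))) * (of_nat (k - 1) / 2) ^ (k - 2 * h))) - 1"
        using main[of 0] by simp
      thus ?thesis by (simp only: half cong: sum.cong)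
    qed
  next
    fix n :: nat assume "n > 0"
    thus "Z k (- of_nat n) =
       1 / fact (k - 1) * (\<Sum>h = 0..(k - 2) div 2. B k (k - 2 * h - 1) *
         ((\<Sum>l = 0..n. (-1) ^ l * of_nat (n choose l) * (of_nat (k - 1) / 2) ^ (2 * l)
             * (2 powi (2 * int h + 1 + 2 * int l - 2 * int n - int k) - 1)
             * zeta (of_int (2 * int h + 1 + 2 * int l - 2 * int n - int k)))
          + (-1) ^ n * fact n / 2
             * (Gamma (of_nat (k - 2 * h) / 2) / Gamma (of_nat (k - 2 * h) / 2 + of_nat n + 1))
             * (of_nat (k - 1) / 2) ^ (k - 2 * h + 2 * n)))"
      using main[of n] by (simp only: Gamma_eq cong: sum.cong) simp
  qed
qed

end
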